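(* Let $f(x)=\sum_{n=1}^\infty \frac{\lambda(n)\sin 2\pi n x}{n^2}$ for real $x$, where $\lambda$ is the Liouville function. If $f(x)\geqslant 0$ for all $0\leqslant x\leqslant 1/4$, then the Riemann Hypothesis (for the Riemann zeta-function) is true.
   Context: The Liouville function $\lambda$ is the completely multiplicative function taking the value $-1$ at every prime, i.e. $\lambda(p_1^{e_1}\cdots p_r^{e_r})=(-1)^{e_1+\dots+e_r}$. The series defining $f$ converges absolutely for every real $x$. *)

theory Defs
  imports
    "HOL-Complex_Analysis.Complex_Analysis"
    "HOL-Computational_Algebra.Computational_Algebra"
begin

text \<open>
  The number of prime factors is counted with multiplicity, as \<^term>\<open>prime_factorization n\<close>
  is a multiset. The value at \<open>0\<close> is irrelevant.
\<close>

definition liouville :: "nat \<Rightarrow> int" where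
  "liouville n = (-1) ^ size (prime_factorization n)"

definition liouville_sine :: "real \<Rightarrow> real" where
  "liouville_sine x =
     (\<Sum>k. of_int (liouville (Suc k)) * sin (2 * pi * real (Suc k) * x) / real (Suc k) ^ 2)"

text \<open>
  The Riemann zeta function is the analytic continuation of the Dirichlet series to the whole
  plane without the point \<open>1\<close>. The conditions determine it uniquely there;
  the value at the pole \<open>1\<close> is left unspecified.
\<close>

definition is_zeta_continuation :: "(complex \<Rightarrow> complex) \<Rightarrow> bool" where
  "is_zeta_continuation z \<longleftrightarrow>
     z holomorphic_on (- {1}) \<and>
     (\<forall>s. Re s > 1 \<longrightarrow> (\<lambda>k. 1 / of_nat (Suc k) powr s) sums z s)"

definition riemann_zeta :: "complex \<Rightarrow> complex" where
  "riemann_zeta = (SOME z. is_zeta_continuation z)"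

text \<open>
  The trivial zeros are the negative even integers. The point \<open>1\<close> is excluded since
  \<^const>\<open>riemann_zeta\<close> has an arbitrary value there.
\<close>

definition Riemann_Hypothesis :: bool where
  "Riemann_Hypothesis \<longleftrightarrow>
     (\<forall>s. s \<noteq> 1 \<longrightarrow> riemann_zeta s = 0 \<longrightarrow>
        (\<nexists>n::nat. n \<ge> 1 \<and> s = - 2 * of_nat n) \<longrightarrow> Re s = 1 / 2)"

lemma liouville_1: "liouville 1 = 1"
  by (simp add: liouville_def)

lemma liouville_prime: "prime p \<Longrightarrow> liouville p = -1"
  by (simp add: liouville_def prime_factorization_prime)

lemma liouville_mult: "m > 0 \<Longrightarrow> n > 0 \<Longrightarrow> liouville (m * n) = liouville m * liouville n"
  by (simp add: liouville_def prime_factorization_mult power_add)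

lemma is_zeta_continuation_unique:
  assumes "is_zeta_continuation z" "is_zeta_continuation w" "s \<noteq> 1"
  shows "z s = w s"
proof (rule analytic_continuation_open[where s = "{s. Re s > 1}" and s' = "- {1}" and f = z and g = w])
  show "{s. Re s > 1} \<noteq> {}"
  proof -
    have "2 \<in> {s. Re s > 1}"
      by simp
    then show ?thesis
      by blast
  qed
  show "connected (- {1::complex})"
    by (rule connected_punctured_universe) simp
  show "z t = w t" if "t \<in> {s. Re s > 1}" for t
    using that assms(1,2) sums_unique2 unfolding is_zeta_continuation_def by blast
qed (use assms in \<open>auto simp: is_zeta_continuation_def open_halfspace_Re_gt\<close>)

end

theory Submission
  imports Defs "HOL-Probability.Sinc_Integral" "HOL-Real_Asymp.Real_Asymp"
begin

text \<open>
  Write \<open>f\<close> for \<^const>\<open>liouville_sine\<close>. Near \<open>0\<close> the size of \<open>f\<close> is governed by the zeros of the zeta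
  function, and this can be read off its Mellin transform. Since
  \<open>\<integral> sin x x powr (w - 1) dx = \<Gamma>(w) sin (\<pi> w / 2)\<close> over \<open>(0, \<infinity>)\<close> for \<open>-1 < w < 0\<close>
  (\<open>has_mellin_sin\<close>), summing over the frequencies \<open>2 \<pi> n\<close> with weights \<open>\<lambda>(n) / n\<^sup>2\<close> gives
  \<open>\<integral> f(x) x powr (w - 1) dx = (2 \<pi>) powr (-w) \<Gamma>(w) sin (\<pi> w / 2) \<zeta>(4 + 2 w) / \<zeta>(2 + w)\<close>,
  because \<open>\<Sum> \<lambda>(n) n powr (-s) = \<zeta>(2 s) / \<zeta>(s)\<close>. The part of the integral over \<open>x > 1/4\<close> is
  holomorphic for \<open>Re w < 0\<close>, so the part over \<open>(0, 1/4]\<close> inherits every singularity of the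
  quotient with \<open>Re w < 0\<close>.

  If \<open>f \<ge> 0\<close> on \<open>(0, 1/4]\<close>, this part is a Mellin transform of a nonnegative function, and Landau's
  theorem applies (\<open>landau_exp_integral\<close>): its abscissa of convergence is a real singularity. But the
  quotient has no real singularity with \<open>-3/2 < w < 0\<close>: the pole of \<open>\<Gamma>\<close> at \<open>w = -1\<close> is cancelled by the
  pole of \<open>\<zeta>\<close> at \<open>1\<close>, and \<open>\<zeta>\<close> has no zero on \<open>(0, 1)\<close>. Hence the quotient is holomorphic for
  \<open>-3/2 < Re w < 0\<close>. As its numerator does not vanish there, \<open>\<zeta>(2 + w)\<close> has no zero, which means that
  \<open>\<zeta>(s) \<noteq> 0\<close> for \<open>1/2 < Re s < 2\<close> (\<open>zeta_pole_free_nonzero_if_liouville_sine_nonneg\<close>). For \<open>Re s > 1\<close> this is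
  classical (\<open>dirichlet_zeta_nonzero\<close>), and the functional equation transfers it to \<open>Re s < 1/2\<close>, apart from
  the trivial zeros.

  The zeta function itself is constructed here from the same toolkit. The Mellin transform of
  \<open>1 / (exp x - 1)\<close> is \<open>\<Gamma>(s) \<zeta>(s)\<close>. Subtracting \<open>1/x - 1/2\<close> near \<open>0\<close> continues it to \<open>Re s > -1\<close>,
  and for \<open>-1 < Re s < 0\<close> the result is the Mellin transform of \<open>1 / (exp x - 1) - 1/x + 1/2\<close> over
  \<open>(0, \<infinity>)\<close>. Expanding that function into the partial fractions \<open>2 x / (x\<^sup>2 + 4 \<pi>\<^sup>2 n\<^sup>2)\<close> and
  integrating term by term yields the functional equation. The Mellin transforms are evaluated for
  real exponents only, where all integrands are real; the resulting identities extend to complex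
  exponents by the identity theorem.
\<close>

section \<open>Integrals of exponentials with a complex parameter\<close>

lemma holomorphic_eq_if_eq_on_real_interval:
  fixes f g :: "complex \<Rightarrow> complex"
  assumes f: "f holomorphic_on S" and g: "g holomorphic_on S" and S: "open S" "connected S"
    and ab: "a < b" "\<And>t. a < t \<Longrightarrow> t < b \<Longrightarrow> of_real t \<in> S"
    and eq: "\<And>t. a < t \<Longrightarrow> t < b \<Longrightarrow> f (of_real t) = g (of_real t)"
    and z: "z \<in> S"
  shows "f z = g z"
proof -
  define c where "c = (a + b) / 2"
  have c: "a < c" "c < b"
    using ab by (auto simp: c_def)
  have "of_real c islimpt (of_real ` {a<..<b} :: complex set)"
    unfolding islimpt_approachable
  proof (intro allI impI)
    fix e :: real assume e: "e > 0"
    define d where "d = c + min (e / 2) ((b - c) / 2)"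
    have d: "d \<in> {a<..<b}" "d \<noteq> c" "\<bar>d - c\<bar> < e"
      using c e by (auto simp: d_def min_def field_simps)
    have "dist (of_real d :: complex) (of_real c) < e"
      unfolding dist_norm of_real_diff[symmetric] norm_of_real by (rule d(3))
    moreover have "(of_real d :: complex) \<noteq> of_real c"
      using d(2) by (simp only: of_real_eq_iff not_False_eq_True)
    moreover have "complex_of_real d \<in> complex_of_real ` {a<..<b}"
      using d(1) by (rule imageI)
    ultimately show "\<exists>x'\<in>complex_of_real ` {a<..<b}. x' \<noteq> of_real c \<and> dist x' (of_real c) < e"
      by blast
  qed
  note limpt = this
  have "f z - g z = 0"
  proof (rule analytic_continuation[where f = "\<lambda>z. f z - g z", OF _ S _ _ limpt])
    show "(\<lambda>z. f z - g z) holomorphic_on S"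
      using f g by (rule holomorphic_on_diff)
    show "complex_of_real ` {a<..<b} \<subseteq> S" "complex_of_real c \<in> S"
      using ab(2) c by auto
    show "f w - g w = 0" if "w \<in> complex_of_real ` {a<..<b}" for w
      using that eq by auto
  qed (rule z)
  then show ?thesis
    by simp
qed

text \<open>
  The exponential series is integrated term by term. Its partial sums are dominated by
  \<open>\<bar>F\<bar> exp (Re w L + \<bar>h\<bar> \<bar>L\<bar>)\<close>, which is at most one of the two integrable functions at the ends of the strip,
  according to the sign of \<open>L\<close>. Since the measure is arbitrary, this covers Laplace and
  Mellin transforms as well as Dirichlet series (counting measure).
\<close>

lemma exp_integral_power_series:
  fixes F :: "'a \<Rightarrow> complex" and L :: "'a \<Rightarrow> real"
  assumes F[measurable]: "F \<in> borel_measurable M" and L[measurable]: "L \<in> borel_measurable M"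
    and a: "integrable M (\<lambda>x. norm (F x) * exp (a * L x))"
    and b: "integrable M (\<lambda>x. norm (F x) * exp (b * L x))"
    and h: "a \<le> Re w - cmod h" "Re w + cmod h \<le> b"
  shows "(\<lambda>k. (LINT x|M. F x * exp (w * of_real (L x)) * of_real (L x ^ k / fact k)) * h ^ k)
           sums (LINT x|M. F x * exp ((w + h) * of_real (L x)))"
proof -
  define g where "g x = norm (F x) * exp (a * L x) + norm (F x) * exp (b * L x)" for x
  have g: "integrable M g"
    unfolding g_def using a b by (rule Bochner_Integration.integrable_add)
  have le: "norm (F x) * exp (Re w * L x + cmod h * \<bar>L x\<bar>) \<le> g x" for x
  proof -
    have "Re w * L x + cmod h * \<bar>L x\<bar> \<le> a * L x \<or> Re w * L x + cmod h * \<bar>L x\<bar> \<le> b * L x"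
    proof (cases "L x \<ge> 0")
      case True
      then have "(Re w + cmod h) * L x \<le> b * L x"
        using h by (intro mult_right_mono) auto
      then show ?thesis
        using True by (simp add: algebra_simps)
    next
      case False
      then have "(Re w - cmod h) * L x \<le> a * L x"
        using h by (intro mult_right_mono_neg) auto
      then show ?thesis
        using False by (simp add: algebra_simps)
    qed
    then have "exp (Re w * L x + cmod h * \<bar>L x\<bar>) \<le> exp (a * L x) + exp (b * L x)"
      by (smt (verit) exp_ge_zero exp_le_cancel_iff)
    then show ?thesis
      unfolding g_def by (metis distrib_left mult_left_mono norm_ge_zero)
  qed
  define T where "T k x = F x * exp (w * of_real (L x)) * of_real (L x ^ k / fact k) * h ^ k" for k x
  have Tm[measurable]: "T k \<in> borel_measurable M" for k
    unfolding T_def by measurable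
  have Teq: "T k x = F x * exp (w * of_real (L x)) * ((h * of_real (L x)) ^ k /\<^sub>R fact k)" for k x
    by (simp add: T_def scaleR_conv_of_real power_mult_distrib divide_inverse)
  have Tsum: "(\<lambda>k. T k x) sums (F x * exp ((w + h) * of_real (L x)))" for x
    using sums_mult[OF exp_converges[of "h * of_real (L x)"], of "F x * exp (w * of_real (L x))"]
    by (simp add: Teq exp_add algebra_simps flip: exp_add)
  have nT: "norm (T k x) = norm (F x) * exp (Re w * L x) * ((cmod h * \<bar>L x\<bar>) ^ k /\<^sub>R fact k)" for k x
    by (simp add: Teq norm_mult norm_power)
  have bound: "(\<Sum>k<n. norm (T k x)) \<le> g x" for n x
  proof -
    have "(\<Sum>k<n. norm (T k x)) = norm (F x) * exp (Re w * L x) * (\<Sum>k<n. (cmod h * \<bar>L x\<bar>) ^ k /\<^sub>R fact k)"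
      unfolding nT by (simp add: sum_distrib_left)
    also have "(\<Sum>k<n. (cmod h * \<bar>L x\<bar>) ^ k /\<^sub>R fact k) \<le> exp (cmod h * \<bar>L x\<bar>)"
      using exp_converges[of "cmod h * \<bar>L x\<bar>"]
      by (metis (no_types, lifting) sums_unique sum_le_suminf sums_summable finite_lessThan
          norm_ge_zero abs_ge_zero mult_nonneg_nonneg zero_le_power inverse_nonnegative_iff_nonnegative
          fact_ge_zero scaleR_nonneg_nonneg)
    also have "norm (F x) * exp (Re w * L x) * exp (cmod h * \<bar>L x\<bar>) =
        norm (F x) * exp (Re w * L x + cmod h * \<bar>L x\<bar>)"
      by (simp add: exp_add)
    also have "\<dots> \<le> g x"
      by (rule le)
    finally show ?thesis
      by (simp add: mult_left_mono)
  qed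
  have Tint: "integrable M (T k)" for k
  proof (rule Bochner_Integration.integrable_bound[OF g])
    have "norm (T k x) \<le> g x" for x
      using bound[of x "Suc k"] sum_nonneg[of "{..<k}" "\<lambda>k. norm (T k x)"] by simp
    then show "AE x in M. norm (T k x) \<le> norm (g x)"
      by (intro always_eventually allI) (smt (verit) real_norm_def)
  qed simp
  have "(\<lambda>n. LINT x|M. (\<Sum>k<n. T k x)) \<longlonglongrightarrow> (LINT x|M. F x * exp ((w + h) * of_real (L x)))"
  proof (rule integral_dominated_convergence[OF _ _ g])
    show "AE x in M. (\<lambda>n. \<Sum>k<n. T k x) \<longlonglongrightarrow> F x * exp ((w + h) * of_real (L x))"
      using Tsum by (simp add: sums_def)
    show "AE x in M. norm (\<Sum>k<n. T k x) \<le> g x" for n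
      using order.trans[OF norm_sum bound] by (intro always_eventually allI)
  qed measurable
  moreover have "(LINT x|M. (\<Sum>k<n. T k x)) =
     (\<Sum>k<n. (LINT x|M. F x * exp (w * of_real (L x)) * of_real (L x ^ k / fact k)) * h ^ k)" for n
  proof -
    have "(LINT x|M. T k x) = (LINT x|M. F x * exp (w * of_real (L x)) * of_real (L x ^ k / fact k)) * h ^ k" for k
      unfolding T_def by (rule integral_mult_left_zero)
    then show ?thesis
      using Tint by (simp add: Bochner_Integration.integral_sum del: of_real_divide of_real_power)
  qed
  ultimately show ?thesis
    by (simp add: sums_def)
qed

lemma exp_integral_holomorphic:
  fixes F :: "'a \<Rightarrow> complex" and L :: "'a \<Rightarrow> real"
  assumes F[measurable]: "F \<in> borel_measurable M" and L[measurable]: "L \<in> borel_measurable M"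
    and int: "\<And>t. A < t \<Longrightarrow> t < B \<Longrightarrow> integrable M (\<lambda>x. norm (F x) * exp (t * L x))"
  shows "(\<lambda>w. LINT x|M. F x * exp (w * of_real (L x))) holomorphic_on {w. A < Re w \<and> Re w < B}"
    (is "?f holomorphic_on _")
proof -
  have "?f field_differentiable at w" if w: "A < Re w" "Re w < B" for w
  proof -
    define r where "r = min (Re w - A) (B - Re w) / 2"
    have r: "r > 0" "A < Re w - r" "Re w + r < B"
      using w by (auto simp: r_def min_def field_simps)
    have "?f holomorphic_on ball w r"
    proof (rule power_series_holomorphic)
      fix z assume "z \<in> ball w r"
      then have "cmod (z - w) < r"
        by (simp add: dist_norm norm_minus_commute)
      then show "(\<lambda>k. (LINT x|M. F x * exp (w * of_real (L x)) * of_real (L x ^ k / fact k)) * (z - w) ^ k)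
        sums ?f z"
        using exp_integral_power_series[OF F L int int, of "Re w - r" "Re w + r" w "z - w"] r w
        by simp
    qed
    then show ?thesis
      using r by (simp add: holomorphic_on_imp_differentiable_at)
  qed
  then show ?thesis
    by (auto simp: holomorphic_on_def intro: field_differentiable_at_within)
qed

lemma open_strip: "open {z. A < Re z \<and> Re z < B}"
  by (intro open_Collect_conj open_halfspace_Re_gt open_halfspace_Re_lt)

lemma convex_strip: "convex {z. A < Re z \<and> Re z < B}"
proof -
  have "{z. A < Re z \<and> Re z < B} = {z. A < Re z} \<inter> {z. Re z < B}"
    by auto
  then show ?thesis
    by (simp add: convex_Int convex_halfspace_Re_gt convex_halfspace_Re_lt)
qed

lemma connected_strip: "connected {z. A < Re z \<and> Re z < B}"
  by (rule convex_connected[OF convex_strip])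

lemma integrable_nonneg_exp_mono:
  fixes F L :: "'a \<Rightarrow> real"
  assumes [measurable]: "F \<in> borel_measurable M" "L \<in> borel_measurable M"
    and pos: "\<And>x. F x \<ge> 0" "\<And>x. F x > 0 \<Longrightarrow> L x \<ge> 0"
    and q: "integrable M (\<lambda>x. F x * exp (q * L x))" and t: "t \<le> q"
  shows "integrable M (\<lambda>x. F x * exp (t * L x))"
proof (rule Bochner_Integration.integrable_bound[OF q])
  have "F x * exp (t * L x) \<le> F x * exp (q * L x)" for x
    using pos[of x] t by (cases "F x = 0") (auto simp: mult_right_mono)
  then show "AE x in M. norm (F x * exp (t * L x)) \<le> norm (F x * exp (q * L x))"
    using pos by (intro always_eventually) (auto simp: abs_mult)
qed measurable

lemma power_div_fact_le_exp:
  fixes x :: real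
  assumes "x \<ge> 0"
  shows "x ^ k / fact k \<le> exp x"
proof -
  have "(\<Sum>n\<in>{k}. x ^ n /\<^sub>R fact n) \<le> (\<Sum>n. x ^ n /\<^sub>R fact n)"
    using assms by (intro sum_le_suminf sums_summable[OF exp_converges]) auto
  then show ?thesis
    by (simp add: exp_def divide_inverse mult.commute)
qed

text \<open>
  This is the core of Landau's theorem. At \<open>p\<close> the transform has the Taylor coefficients
  \<open>\<integral> F exp (p L) L^k / k!\<close>, which are nonnegative. If \<open>H\<close> continues it holomorphically to a disc
  that reaches beyond the known range of convergence, then the Taylor series converges at \<open>p + h\<close>.
  There the sum and the integral of nonnegative terms may be exchanged, so that the integral itself
  is finite.
\<close>

lemma nonneg_exp_integral_extend:
  fixes F L :: "'a \<Rightarrow> real" and H :: "complex \<Rightarrow> complex"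
  assumes F[measurable]: "F \<in> borel_measurable M" and L[measurable]: "L \<in> borel_measurable M"
    and pos: "\<And>x. F x \<ge> 0" "\<And>x. F x > 0 \<Longrightarrow> L x \<ge> 0"
    and q: "p < q" "integrable M (\<lambda>x. F x * exp (q * L x))"
    and H: "H holomorphic_on ball (of_real p) R"
      "\<And>z. z \<in> ball (of_real p) R \<Longrightarrow> Re z < q \<Longrightarrow>
         H z = (LINT x|M. of_real (F x) * exp (z * of_real (L x)))"
    and h: "0 < h" "h < R"
  shows "integrable M (\<lambda>x. F x * exp ((p + h) * L x))"
proof -
  define a where "a k = (LINT x|M. F x * exp (p * L x) * (L x ^ k / fact k))" for k
  have int_le: "integrable M (\<lambda>x. F x * exp (t * L x))" if "t \<le> q" for t
    using F L pos q(2) that by (rule integrable_nonneg_exp_mono)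
  have ps: "(\<lambda>k. of_real (a k) * z ^ k) sums
      (LINT x|M. of_real (F x) * exp ((of_real p + z) * of_real (L x)))" if "cmod z \<le> q - p" for z
  proof -
    have "(\<lambda>k. (LINT x|M. of_real (F x) * exp (of_real p * of_real (L x)) * of_real (L x ^ k / fact k)) * z ^ k)
      sums (LINT x|M. of_real (F x) * exp ((of_real p + z) * of_real (L x)))"
      using that pos int_le[of "2 * p - q"] int_le[of q] q
      by (intro exp_integral_power_series[where a = "2 * p - q" and b = q]) auto
    moreover have "(LINT x|M. of_real (F x) * exp (of_real p * of_real (L x)) * of_real (L x ^ k / fact k))
       = complex_of_real (a k)" for k
      unfolding a_def integral_complex_of_real[symmetric] by (simp flip: exp_of_real)
    ultimately show ?thesis
      by (simp only:)
  qed
  define G where "G u = H (of_real p + u)" for u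
  have G: "G holomorphic_on ball 0 R"
    unfolding G_def
    by (rule holomorphic_on_compose_gen[OF _ H(1), unfolded comp_def]) (auto intro!: holomorphic_intros simp: dist_norm)
  define r where "r = min R (q - p)"
  have r: "r > 0" "r \<le> R" "r \<le> q - p"
    using h q by (auto simp: r_def)
  \<comment> \<open>Near \<open>p\<close> the function \<open>H\<close> is the integral, so the \<open>a k\<close> are its Taylor coefficients.\<close>
  have "(\<lambda>k. of_real (a k) * u ^ k) sums G u" if "u \<in> ball 0 r" for u
  proof -
    have "Re u \<le> cmod u" "cmod u < r"
      using that complex_Re_le_cmod by auto
    then show ?thesis
      using ps[of u] H(2)[of "of_real p + u"] r by (simp add: G_def dist_norm)
  qed
  then have "eventually (\<lambda>u. (\<lambda>k. of_real (a k) * u ^ k) sums G u) (nhds 0)"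
    using r by (auto simp: eventually_nhds intro!: exI[of _ "ball 0 r"])
  then have "G has_fps_expansion Abs_fps (\<lambda>k. of_real (a k))"
    by (intro has_fps_expansionI) simp
  then have coeff: "(deriv ^^ k) G 0 / fact k = of_real (a k)" for k
    using fps_nth_fps_expansion by (metis fps_nth_Abs_fps)
  have "(\<lambda>k. (deriv ^^ k) G 0 / fact k * (of_real h - 0) ^ k) sums G (of_real h)"
    using h by (intro holomorphic_power_series[OF G]) auto
  then have "(\<lambda>k. Re (of_real (a k) * of_real h ^ k)) sums Re (G (of_real h))"
    unfolding coeff by (intro sums_Re) simp
  also have "(\<lambda>k. Re (of_real (a k) * of_real h ^ k)) = (\<lambda>k. a k * h ^ k)"
    by (simp flip: of_real_power of_real_mult)
  finally have sm: "summable (\<lambda>k. a k * h ^ k)"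
    by (rule sums_summable)
  define T where "T k x = F x * exp (p * L x) * (L x ^ k / fact k)" for k x
  have T[measurable]: "T k \<in> borel_measurable M" for k
    unfolding T_def by measurable
  have T_pos: "T k x \<ge> 0" for k x
    using pos[of x] by (cases "F x = 0") (auto simp: T_def)
  have int_k: "integrable M (T k)" for k
  proof -
    have "T k x * (q - p) ^ k \<le> F x * exp (q * L x)" for x
    proof (cases "F x = 0")
      case False
      then have Lx: "L x \<ge> 0" "F x > 0"
        using pos[of x] by auto
      have "(L x * (q - p)) ^ k / fact k \<le> exp (L x * (q - p))"
        using Lx q by (intro power_div_fact_le_exp) auto
      then have "F x * exp (p * L x) * ((L x * (q - p)) ^ k / fact k) \<le>
        F x * exp (p * L x) * exp (L x * (q - p))"
        using Lx by (intro mult_left_mono) auto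
      also have "\<dots> = F x * exp (q * L x)"
        by (simp add: algebra_simps flip: exp_add)
      finally show ?thesis
        by (simp add: T_def power_mult_distrib)
    qed (auto simp: T_def)
    then have "norm (T k x * (q - p) ^ k) \<le> norm (F x * exp (q * L x))" for x
      using pos T_pos q by (simp add: abs_mult)
    then have "integrable M (\<lambda>x. T k x * (q - p) ^ k)"
      by (intro Bochner_Integration.integrable_bound[OF q(2)] always_eventually allI) auto
    then show ?thesis
      using q by simp
  qed
  show ?thesis
  proof (rule integrableI_nonneg)
    have "ennreal (F x * exp ((p + h) * L x)) = (\<Sum>k. ennreal (T k x * h ^ k))" for x
    proof -
      have "(\<lambda>k. F x * exp (p * L x) * ((h * L x) ^ k /\<^sub>R fact k)) sums (F x * exp (p * L x) * exp (h * L x))"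
        by (intro sums_mult exp_converges)
      then have "(\<lambda>k. T k x * h ^ k) sums (F x * exp ((p + h) * L x))"
        by (simp add: T_def exp_add algebra_simps power_mult_distrib divide_inverse)
      then show ?thesis
        using T_pos h by (intro suminf_ennreal_eq[symmetric]) auto
    qed
    then have "(\<integral>\<^sup>+x. ennreal (F x * exp ((p + h) * L x)) \<partial>M) = (\<Sum>k. \<integral>\<^sup>+x. ennreal (T k x * h ^ k) \<partial>M)"
      by (simp add: nn_integral_suminf)
    moreover have "(\<integral>\<^sup>+x. ennreal (T k x * h ^ k) \<partial>M) = ennreal (a k * h ^ k)" for k
    proof -
      have "(LINT x|M. T k x * h ^ k) = a k * h ^ k"
        unfolding a_def T_def by (rule integral_mult_left_zero)
      moreover have "(\<integral>\<^sup>+x. ennreal (T k x * h ^ k) \<partial>M) = ennreal (LINT x|M. T k x * h ^ k)"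
        using int_k T_pos h by (intro nn_integral_eq_integral) auto
      ultimately show ?thesis
        by (simp only:)
    qed
    moreover have "(\<Sum>k. ennreal (a k * h ^ k)) = ennreal (\<Sum>k. a k * h ^ k)"
    proof (intro suminf_ennreal_eq summable_sums sm)
      have "a k = (LINT x|M. T k x)" for k
        by (simp only: a_def T_def)
      then have "a k \<ge> 0" for k
        using T_pos by (simp only: Bochner_Integration.integral_nonneg)
      then show "0 \<le> a k * h ^ k" for k
        using h by simp
    qed
    ultimately show "(\<integral>\<^sup>+x. ennreal (F x * exp ((p + h) * L x)) \<partial>M) < \<infinity>"
      by (simp only: ennreal_less_top infinity_ennreal_def)
  qed (use pos in auto)
qed

text \<open>
  Landau's theorem for an integral \<open>\<phi>\<close> which is known to be the quotient \<open>K / Z\<close> on a short real interval.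
  The identity is stated as \<open>Z \<phi> = K\<close> so that both sides are holomorphic on the convex strip where
  \<open>\<phi>\<close> converges, whether or not \<open>Z\<close> has complex zeros. Zeros of \<open>Z\<close> are excluded only at the real points,
  where the abscissa of convergence could lie. If that abscissa \<open>c\<close> were below \<open>B\<close>, then \<open>K / Z\<close> would be
  holomorphic near \<open>c\<close>, and the integral would converge beyond \<open>c\<close>.
\<close>

lemma landau_exp_integral:
  fixes F L :: "'a \<Rightarrow> real" and Z K :: "complex \<Rightarrow> complex"
  assumes F[measurable]: "F \<in> borel_measurable M" and L[measurable]: "L \<in> borel_measurable M"
    and pos: "\<And>x. F x \<ge> 0" "\<And>x. F x > 0 \<Longrightarrow> L x \<ge> 0"
    and AB: "A < t1" "t1 < B"
    and int: "integrable M (\<lambda>x. F x * exp (t1 * L x))"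
    and hol: "Z holomorphic_on {z. A < Re z \<and> Re z < B}" "K holomorphic_on {z. A < Re z \<and> Re z < B}"
    and nz: "\<And>t. t1 \<le> t \<Longrightarrow> t < B \<Longrightarrow> Z (of_real t) \<noteq> 0"
    and eq: "\<And>t. A < t \<Longrightarrow> t < t1 \<Longrightarrow>
      Z (of_real t) * (LINT x|M. of_real (F x) * exp (of_real t * of_real (L x))) = K (of_real t)"
    and z: "A < Re z" "Re z < B"
  shows "Z z * (LINT x|M. of_real (F x) * exp (z * of_real (L x))) = K z"
proof -
  define \<phi> where "\<phi> z = (LINT x|M. of_real (F x) * exp (z * complex_of_real (L x)))" for z
  define I where "I t \<longleftrightarrow> integrable M (\<lambda>x. F x * exp (t * L x))" for t
  have I_mono: "I s" if "I t" "s \<le> t" for s t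
    using F L pos that unfolding I_def by (rule integrable_nonneg_exp_mono)
  \<comment> \<open>The identity theorem spreads the identity over any half-plane of convergence.\<close>
  have \<phi>_eq: "Z w * \<phi> w = K w" if c: "t1 \<le> c" "c \<le> B" "\<And>t. t < c \<Longrightarrow> I t" and w: "A < Re w" "Re w < c" for c w
  proof (rule holomorphic_eq_if_eq_on_real_interval[where f = "\<lambda>z. Z z * \<phi> z" and g = K and S = "{z. A < Re z \<and> Re z < c}" and a = A and b = t1])
    have "\<phi> holomorphic_on {z. A < Re z \<and> Re z < c}"
      unfolding \<phi>_def using c pos by (intro exp_integral_holomorphic) (auto simp: I_def)
    moreover have Zc: "Z holomorphic_on {z. A < Re z \<and> Re z < c}"
      using hol(1) by (rule holomorphic_on_subset) (use c in auto)
    ultimately show "(\<lambda>z. Z z * \<phi> z) holomorphic_on {z. A < Re z \<and> Re z < c}"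
      by (intro holomorphic_intros)
    show "K holomorphic_on {z. A < Re z \<and> Re z < c}"
      using hol(2) by (rule holomorphic_on_subset) (use c in auto)
  qed (use c w AB eq in \<open>auto simp: open_strip connected_strip \<phi>_def\<close>)
  have all: "I t" if "t < B" for t
  proof (rule ccontr)
    assume nI: "\<not> I t"
    define c where "c = Sup {s. I s}"
    have bdd: "bdd_above {s. I s}"
      using nI I_mono by (intro bdd_aboveI[of _ t]) (metis linear mem_Collect_eq)
    have I1: "I t1"
      using int by (simp add: I_def)
    have c1: "t1 \<le> c"
      unfolding c_def using bdd I1 by (intro cSup_upper) auto
    have c2: "c \<le> t"
      unfolding c_def using I1 nI I_mono by (intro cSup_least) (auto, metis linear)
    have Ic: "I s" if "s < c" for s
      using that I1 less_cSup_iff[OF _ bdd, of s] I_mono unfolding c_def by force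
    have notI: "\<not> I s" if "s > c" for s
      using that cSup_upper[OF _ bdd, of s] unfolding c_def by auto
    have "Z (of_real c) \<noteq> 0"
      using c1 c2 \<open>t < B\<close> by (intro nz) auto
    moreover have "isCont Z (of_real c)"
      using holomorphic_on_imp_continuous_on[OF hol(1)] c1 c2 AB \<open>t < B\<close>
      by (auto simp: continuous_on_eq_continuous_at[OF open_strip])
    ultimately obtain e where e: "e > 0" "\<And>y. dist (of_real c) y < e \<Longrightarrow> Z y \<noteq> 0"
      using continuous_at_avoid by blast
    define r where "r = min e (min (c - A) (B - c))"
    have r: "r > 0" "r \<le> e" "r \<le> c - A" "r \<le> B - c"
      using e c1 c2 AB \<open>t < B\<close> by (auto simp: r_def)
    have r_in: "Z y \<noteq> 0 \<and> A < Re y \<and> Re y < B" if "y \<in> ball (of_real c) r" for y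
    proof -
      have "\<bar>Re y - c\<bar> < r"
        using that abs_Re_le_cmod[of "y - of_real c"] by (auto simp: dist_norm norm_minus_commute)
      then show ?thesis
        using r e that by auto
    qed
    \<comment> \<open>The disc about \<open>p\<close> with radius \<open>3 r / 4\<close> lies in the disc about \<open>c\<close> and contains \<open>c + r / 4\<close>.\<close>
    define p where "p = c - r / 4"
    have sub: "ball (of_real p) (3 * r / 4) \<subseteq> ball (of_real c :: complex) r"
    proof
      fix y :: complex assume "y \<in> ball (of_real p) (3 * r / 4)"
      moreover have "dist (of_real c) (of_real p :: complex) = r / 4"
        using r by (simp add: p_def dist_norm flip: of_real_diff)
      ultimately show "y \<in> ball (of_real c) r"
        using dist_triangle[of "of_real c" y "of_real p"] by simp
    qed
    have "integrable M (\<lambda>x. F x * exp ((p + r / 2) * L x))"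
    proof (rule nonneg_exp_integral_extend[where q = "c - r / 8" and H = "\<lambda>z. K z / Z z" and R = "3 * r / 4"])
      show "integrable M (\<lambda>x. F x * exp ((c - r / 8) * L x))"
        using Ic[of "c - r / 8"] r by (simp add: I_def)
      show "(\<lambda>z. K z / Z z) holomorphic_on ball (of_real p) (3 * r / 4)"
        using r_in sub by (intro holomorphic_intros holomorphic_on_subset[OF hol(1)] holomorphic_on_subset[OF hol(2)]) auto
      show "K y / Z y = (LINT x|M. of_real (F x) * exp (y * of_real (L x)))"
        if "y \<in> ball (of_real p) (3 * r / 4)" "Re y < c - r / 8" for y
      proof -
        have "Z y * \<phi> y = K y"
          using that r_in[of y] sub r c1 c2 \<open>t < B\<close> Ic by (intro \<phi>_eq[of c]) auto
        moreover have "Z y \<noteq> 0"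
          using r_in[of y] sub that by blast
        ultimately show ?thesis
          unfolding \<phi>_def by (metis nonzero_mult_div_cancel_left)
      qed
    next
      show "p < c - r / 8" "0 < r / 2" "r / 2 < 3 * r / 4"
        using r by (auto simp: p_def)
    qed (use pos in auto)
    moreover have "p + r / 2 = c + r / 4"
      by (simp add: p_def)
    ultimately show False
      using notI[of "c + r / 4"] r by (simp add: I_def)
  qed
  show ?thesis
    using \<phi>_eq[of B z] z AB all by (simp add: \<phi>_def)
qed

section \<open>Mellin transforms\<close>

text \<open>
  For a real exponent the Mellin transform is an absolutely convergent real integral with value \<open>v\<close>.
  The version \<open>mellin\<close> below for complex exponents writes \<open>x powr s\<close> as \<open>exp (s ln x)\<close>, which puts
  it in the form of the integrals of the previous section.
\<close>

definition has_mellin :: "(real \<Rightarrow> real) \<Rightarrow> real \<Rightarrow> real \<Rightarrow> bool" where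
  "has_mellin f \<sigma> v \<longleftrightarrow>
     has_bochner_integral lborel (\<lambda>x. indicat_real {0<..} x * (f x * x powr (\<sigma> - 1))) v"

definition mellin_integrable :: "(real \<Rightarrow> real) \<Rightarrow> real \<Rightarrow> bool" where
  "mellin_integrable f \<sigma> \<longleftrightarrow>
     integrable lborel (\<lambda>x. indicat_real {0<..} x * (f x * x powr (\<sigma> - 1)))"

definition mellin :: "(real \<Rightarrow> real) \<Rightarrow> complex \<Rightarrow> complex" where
  "mellin f s = (LINT x|lborel. of_real (indicat_real {0<..} x * f x / x) * exp (s * of_real (ln x)))"

lemma has_mellin_integrable: "has_mellin f \<sigma> v \<Longrightarrow> mellin_integrable f \<sigma>"
  by (auto simp: has_mellin_def mellin_integrable_def has_bochner_integral_iff)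

lemma mellin_kernel_eq:
  "indicat_real {0<..} x * f x / x * exp (\<sigma> * ln x) = indicat_real {0<..} x * (f x * x powr (\<sigma> - 1))"
  by (auto simp: indicator_def powr_def algebra_simps exp_diff)

lemma mellin_of_real:
  assumes "has_mellin f \<sigma> v"
  shows "mellin f (of_real \<sigma>) = of_real v"
proof -
  have "mellin f (of_real \<sigma>) =
      (LINT x|lborel. complex_of_real (indicat_real {0<..} x * (f x * x powr (\<sigma> - 1))))"
    unfolding mellin_def mellin_kernel_eq[symmetric] by (simp flip: exp_of_real)
  also have "\<dots> = of_real v"
    using assms unfolding has_mellin_def has_bochner_integral_iff integral_complex_of_real by simp
  finally show ?thesis .
qed

lemma mellin_integrableD:
  "mellin_integrable f \<sigma> \<Longrightarrow> \<exists>v. has_mellin f \<sigma> v"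
  by (auto simp: has_mellin_def mellin_integrable_def has_bochner_integral_iff)

lemma mellin_integrable_exp:
  assumes "mellin_integrable f \<sigma>"
  shows "integrable lborel (\<lambda>x. norm (complex_of_real (indicat_real {0<..} x * f x / x)) * exp (\<sigma> * ln x))"
proof -
  have "norm (complex_of_real (indicat_real {0<..} x * f x / x)) * exp (\<sigma> * ln x) =
      norm (indicat_real {0<..} x * (f x * x powr (\<sigma> - 1)))" for x
    unfolding mellin_kernel_eq[symmetric] norm_of_real by (simp add: abs_mult)
  then show ?thesis
    using assms unfolding mellin_integrable_def by simp
qed

lemma mellin_holomorphic:
  assumes [measurable]: "f \<in> borel_measurable borel"
    and "\<And>\<sigma>. A < \<sigma> \<Longrightarrow> \<sigma> < B \<Longrightarrow> mellin_integrable f \<sigma>"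
  shows "mellin f holomorphic_on {s. A < Re s \<and> Re s < B}"
  unfolding mellin_def using assms(2)
  by (intro exp_integral_holomorphic mellin_integrable_exp) measurable

lemma has_mellin_add: "has_mellin f \<sigma> u \<Longrightarrow> has_mellin g \<sigma> v \<Longrightarrow> has_mellin (\<lambda>x. f x + g x) \<sigma> (u + v)"
  unfolding has_mellin_def by (drule (1) has_bochner_integral_add) (simp add: algebra_simps)

lemma has_mellin_cmult: "has_mellin f \<sigma> v \<Longrightarrow> has_mellin (\<lambda>x. c * f x) \<sigma> (c * v)"
proof -
  assume "has_mellin f \<sigma> v"
  then have "has_bochner_integral lborel (\<lambda>x. c * (indicat_real {0<..} x * (f x * x powr (\<sigma> - 1)))) (c * v)"
    unfolding has_mellin_def by (intro has_bochner_integral_mult_right)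
  then show ?thesis
    by (simp add: has_mellin_def mult_ac)
qed

lemma has_mellin_cong:
  assumes "\<And>x. x > 0 \<Longrightarrow> f x = g x"
  shows "has_mellin f \<sigma> v \<longleftrightarrow> has_mellin g \<sigma> v"
proof -
  have "(\<lambda>x. indicat_real {0<..} x * (f x * x powr (\<sigma> - 1))) =
      (\<lambda>x. indicat_real {0<..} x * (g x * x powr (\<sigma> - 1)))"
    using assms by (auto simp: indicator_def)
  then show ?thesis
    by (simp add: has_mellin_def)
qed

lemma has_mellin_scale:
  assumes "has_mellin f \<sigma> v" "a > 0"
  shows "has_mellin (\<lambda>x. f (a * x)) \<sigma> (a powr - \<sigma> * v)"
proof -
  have "has_bochner_integral lborel
      (\<lambda>x. indicat_real {0<..} (0 + a * x) * (f (0 + a * x) * (0 + a * x) powr (\<sigma> - 1))) (v /\<^sub>R \<bar>a\<bar>)"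
    using assms(1) unfolding has_mellin_def
    by (subst (asm) lborel_has_bochner_integral_real_affine_iff[of a _ v 0]) (use assms(2) in auto)
  then have "has_bochner_integral lborel (\<lambda>x. a powr (1 - \<sigma>) *
      (indicat_real {0<..} (0 + a * x) * (f (0 + a * x) * (0 + a * x) powr (\<sigma> - 1)))) (a powr (1 - \<sigma>) * (v /\<^sub>R \<bar>a\<bar>))"
    by (intro has_bochner_integral_mult_right)
  moreover have "a powr (1 - \<sigma>) * (indicat_real {0<..} (0 + a * x) * (f (0 + a * x) * (0 + a * x) powr (\<sigma> - 1)))
     = indicat_real {0<..} x * (f (a * x) * x powr (\<sigma> - 1))" for x
  proof (cases "x > 0")
    case True
    have "a powr (1 - \<sigma>) * a powr (\<sigma> - 1) = 1"
      using assms by (simp flip: powr_add)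
    then show ?thesis
      using True assms by (simp add: powr_mult)
  qed (use assms in \<open>auto simp: zero_less_mult_iff\<close>)
  moreover have "a powr (1 - \<sigma>) * (v /\<^sub>R \<bar>a\<bar>) = a powr - \<sigma> * v"
    using assms by (simp add: powr_diff powr_minus divide_simps)
  ultimately show ?thesis
    by (simp only: has_mellin_def)
qed

lemma mellin_integrable_bound:
  assumes [measurable]: "f \<in> borel_measurable borel"
    and "mellin_integrable g \<tau>"
    and "\<And>x. x > 0 \<Longrightarrow> \<bar>f x\<bar> * x powr (\<sigma> - 1) \<le> \<bar>g x\<bar> * x powr (\<tau> - 1)"
  shows "mellin_integrable f \<sigma>"
  unfolding mellin_integrable_def
proof (rule Bochner_Integration.integrable_bound[OF assms(2)[unfolded mellin_integrable_def]])
  show "AE x in lborel. norm (indicat_real {0<..} x * (f x * x powr (\<sigma> - 1)))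
      \<le> norm (indicat_real {0<..} x * (g x * x powr (\<tau> - 1)))"
    using assms(3) by (intro always_eventually allI) (auto simp: indicator_def abs_mult)
qed measurable

lemma mellin_integrable_near_0:
  assumes "f \<in> borel_measurable borel" "mellin_integrable f \<sigma>" "\<sigma> \<le> \<tau>"
  shows "mellin_integrable (\<lambda>x. if x \<le> 1 then f x else 0) \<tau>"
  using assms by (intro mellin_integrable_bound[OF _ assms(2)]) (auto intro!: mult_left_mono powr_mono')

lemma mellin_integrable_near_infinity:
  assumes "f \<in> borel_measurable borel" "mellin_integrable f \<sigma>" "\<tau> \<le> \<sigma>"
  shows "mellin_integrable (\<lambda>x. if x \<le> 1 then 0 else f x) \<tau>"
  using assms by (intro mellin_integrable_bound[OF _ assms(2)]) (auto intro!: mult_left_mono powr_mono)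

lemma has_mellin_nonnegI:
  assumes [measurable]: "f \<in> borel_measurable borel" and "\<And>x. x > 0 \<Longrightarrow> f x \<ge> 0"
    and int: "((\<lambda>x. f x * x powr (\<sigma> - 1)) has_integral v) {0<..}"
  shows "has_mellin f \<sigma> v"
proof -
  define g where "g x = indicat_real {0<..} x * (f x * x powr (\<sigma> - 1))" for x
  have g[measurable]: "g \<in> borel_measurable borel"
    unfolding g_def by measurable
  have g0: "g x \<ge> 0" for x
    using assms(2) by (auto simp: g_def indicator_def)
  have "g = (\<lambda>x. if x \<in> {0<..} then f x * x powr (\<sigma> - 1) else 0)"
    by (auto simp: g_def indicator_def)
  then have gi: "(g has_integral v) UNIV"
    using int by (simp only: has_integral_restrict_UNIV)
  then have "v \<ge> 0"
    using g0 by (rule has_integral_nonneg) 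
  then have "has_bochner_integral lborel g v"
    using nn_integral_has_integral_lborel[OF g g0 gi] g0
    by (intro has_bochner_integral_nn_integral) auto
  then show ?thesis
    by (simp only: has_mellin_def g_def[abs_def])
qed

lemma has_mellin_powr_near_0:
  assumes "a + \<sigma> > 0"
  shows "has_mellin (\<lambda>x. if x \<le> 1 then x powr a else 0) \<sigma> (1 / (a + \<sigma>))"
proof (rule has_mellin_nonnegI)
  have "((\<lambda>x. x powr (a + \<sigma> - 1)) has_integral (1 powr (a + \<sigma> - 1 + 1) / (a + \<sigma> - 1 + 1))) {0..1}"
    using assms by (intro has_integral_powr_from_0) auto
  then have "((\<lambda>x. x powr (a + \<sigma> - 1)) has_integral (1 / (a + \<sigma>))) {0..1}"
    by simp
  also have "?this \<longleftrightarrow> ((\<lambda>x. x powr (a + \<sigma> - 1)) has_integral (1 / (a + \<sigma>))) {0<..1}"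
    by (intro has_integral_spike_set_eq negligible_subset[OF negligible_sing[of 0]]) auto
  also have "\<dots> \<longleftrightarrow> ((\<lambda>x. if x \<in> {0<..1} then x powr (a + \<sigma> - 1) else 0) has_integral (1 / (a + \<sigma>))) {0<..}"
    by (rule has_integral_restrict[symmetric]) auto
  also have "\<dots> \<longleftrightarrow> ((\<lambda>x. (if x \<le> 1 then x powr a else 0) * x powr (\<sigma> - 1)) has_integral (1 / (a + \<sigma>))) {0<..}"
    by (intro has_integral_cong) (auto simp: algebra_simps simp flip: powr_add)
  finally show "((\<lambda>x. (if x \<le> 1 then x powr a else 0) * x powr (\<sigma> - 1)) has_integral (1 / (a + \<sigma>))) {0<..}" .
qed auto

lemma has_mellin_powr_near_infinity:
  assumes "a + \<sigma> < 0"
  shows "has_mellin (\<lambda>x. if x \<le> 1 then 0 else x powr a) \<sigma> (- 1 / (a + \<sigma>))"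
proof (rule has_mellin_nonnegI)
  have "((\<lambda>x. x powr (a + \<sigma> - 1)) has_integral (-(1 powr (a + \<sigma> - 1 + 1)) / (a + \<sigma> - 1 + 1))) {1..}"
    using assms by (intro has_integral_powr_to_inf) auto
  then have "((\<lambda>x. x powr (a + \<sigma> - 1)) has_integral (- 1 / (a + \<sigma>))) {1..}"
    by simp
  also have "?this \<longleftrightarrow> ((\<lambda>x. x powr (a + \<sigma> - 1)) has_integral (- 1 / (a + \<sigma>))) {1<..}"
    by (intro has_integral_spike_set_eq negligible_subset[OF negligible_sing[of 1]]) auto
  also have "\<dots> \<longleftrightarrow> ((\<lambda>x. if x \<in> {1<..} then x powr (a + \<sigma> - 1) else 0) has_integral (- 1 / (a + \<sigma>))) {0<..}"
    by (rule has_integral_restrict[symmetric]) auto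
  also have "\<dots> \<longleftrightarrow> ((\<lambda>x. (if x \<le> 1 then 0 else x powr a) * x powr (\<sigma> - 1)) has_integral (- 1 / (a + \<sigma>))) {0<..}"
    by (intro has_integral_cong) (auto simp: algebra_simps simp flip: powr_add)
  finally show "((\<lambda>x. (if x \<le> 1 then 0 else x powr a) * x powr (\<sigma> - 1)) has_integral (- 1 / (a + \<sigma>))) {0<..}" .
qed auto

text \<open>
  Dilating the argument of \<open>g\<close> by \<open>a\<close> multiplies its Mellin transform by \<open>a powr (-\<sigma>)\<close>. The Mellin transform of a
  superposition of dilates of \<open>g\<close> is thus that of \<open>g\<close> times a generalised Dirichlet series. All
  connections between functions and Dirichlet series below are instances of this.
\<close>

lemma has_mellin_series:
  assumes g: "has_mellin g \<sigma> G" and a: "\<And>n. a n > 0"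
    and sm: "summable (\<lambda>n. \<bar>c n\<bar> * a n powr - \<sigma>)"
    and abs: "\<And>x. x > 0 \<Longrightarrow> summable (\<lambda>n. \<bar>c n * g (a n * x)\<bar>)"
    and h: "\<And>x. x > 0 \<Longrightarrow> h x = (\<Sum>n. c n * g (a n * x))"
  shows "has_mellin h \<sigma> (G * (\<Sum>n. c n * a n powr - \<sigma>))"
proof -
  define T where "T n x = indicat_real {0<..} x * (c n * g (a n * x) * x powr (\<sigma> - 1))" for n x
  have "has_mellin (\<lambda>x. c n * g (a n * x)) \<sigma> (c n * (a n powr - \<sigma> * G))" for n
    by (intro has_mellin_cmult has_mellin_scale g a)
  then have T: "has_bochner_integral lborel (T n) (c n * (a n powr - \<sigma> * G))" for n
    by (simp only: has_mellin_def T_def[abs_def])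
  obtain N where N: "has_mellin (\<lambda>x. \<bar>g x\<bar>) \<sigma> N"
  proof -
    have "integrable lborel (\<lambda>x. norm (indicat_real {0<..} x * (g x * x powr (\<sigma> - 1))))"
      using g by (intro integrable_norm) (auto simp: has_mellin_def has_bochner_integral_iff)
    also have "(\<lambda>x. norm (indicat_real {0<..} x * (g x * x powr (\<sigma> - 1)))) =
        (\<lambda>x. indicat_real {0<..} x * (\<bar>g x\<bar> * x powr (\<sigma> - 1)))"
      by (auto simp: abs_mult)
    finally show ?thesis
      using that mellin_integrableD mellin_integrable_def by blast
  qed
  have "has_mellin (\<lambda>x. \<bar>c n\<bar> * \<bar>g (a n * x)\<bar>) \<sigma> (\<bar>c n\<bar> * (a n powr - \<sigma> * N))" for n
    by (intro has_mellin_cmult has_mellin_scale[of "\<lambda>x. \<bar>g x\<bar>"] N a)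
  then have "(LINT x|lborel. norm (T n x)) = \<bar>c n\<bar> * (a n powr - \<sigma> * N)" for n
    by (simp add: has_mellin_def has_bochner_integral_iff T_def abs_mult)
  then have norm_sm: "summable (\<lambda>n. LINT x|lborel. norm (T n x))"
    using summable_mult2[OF sm, of N] by (simp add: mult.assoc)
  have abs': "summable (\<lambda>n. norm (T n x))" for x
  proof (cases "x > 0")
    case True
    then show ?thesis
      using summable_mult2[OF abs[OF True], of "x powr (\<sigma> - 1)"] by (simp add: T_def abs_mult)
  qed (simp add: T_def)
  have int: "integrable lborel (T n)" for n
    using T by (auto simp: has_bochner_integral_iff)
  have sumT: "(\<Sum>n. T n x) = indicat_real {0<..} x * (h x * x powr (\<sigma> - 1))" for x
  proof (cases "x > 0")
    case True
    then show ?thesis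
      using suminf_mult2[OF summable_rabs_cancel[OF abs[OF True]], of "x powr (\<sigma> - 1)"] h[OF True] by (simp add: T_def)
  qed (simp add: T_def)
  have "has_bochner_integral lborel (\<lambda>x. \<Sum>n. T n x) (\<Sum>n. LINT x|lborel. T n x)"
    unfolding has_bochner_integral_iff
    using integrable_suminf[OF int _ norm_sm] integral_suminf[OF int _ norm_sm] abs' by auto
  moreover have "(\<Sum>n. LINT x|lborel. T n x) = G * (\<Sum>n. c n * a n powr - \<sigma>)"
  proof -
    have "summable (\<lambda>n. c n * a n powr - \<sigma>)"
      using sm by (intro summable_rabs_cancel[where f = "\<lambda>n. c n * a n powr - \<sigma>"]) (simp add: abs_mult)
    then have "G * (\<Sum>n. c n * a n powr - \<sigma>) = (\<Sum>n. G * (c n * a n powr - \<sigma>))"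
      by (rule suminf_mult[symmetric])
    also have "\<dots> = (\<Sum>n. LINT x|lborel. T n x)"
      using T by (intro arg_cong[where f = suminf]) (auto simp: has_bochner_integral_iff fun_eq_iff mult_ac)
    finally show ?thesis ..
  qed
  ultimately show ?thesis
    by (simp add: has_mellin_def sumT)
qed

lemma has_mellin_exp:
  assumes "s > 0"
  shows "has_mellin (\<lambda>x. exp (- x)) s (Gamma s)"
proof (rule has_mellin_nonnegI)
  have "((\<lambda>t. t powr (s - 1) / exp t) has_integral Gamma s) {0<..}"
    using Gamma_integral_real[OF assms]
    by (subst has_integral_spike_set_eq[of _ "{0..}"]) (auto intro!: negligible_subset[OF negligible_sing[of 0]])
  then show "((\<lambda>x. exp (- x) * x powr (s - 1)) has_integral Gamma s) {0<..}"
    by (simp add: exp_minus field_simps)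
qed auto

lemma Gamma_reflection_real:
  fixes x :: real
  shows "Gamma x * Gamma (1 - x) = pi / sin (pi * x)"
proof -
  have "complex_of_real (Gamma x * Gamma (1 - x)) = Gamma (of_real x) * Gamma (1 - of_real x)"
    by (simp only: of_real_mult Gamma_complex_of_real[symmetric] of_real_diff of_real_1)
  also have "\<dots> = of_real (pi / sin (pi * x))"
    unfolding Gamma_reflection_complex by (simp flip: sin_of_real)
  finally show ?thesis
    by (simp only: of_real_eq_iff)
qed

text \<open>
  The substitution \<open>v = x\<^sup>2 / (1 + x\<^sup>2)\<close> turns the integral into a Beta integral with parameters
  \<open>(1 + s) / 2\<close> and \<open>(1 - s) / 2\<close>. These add up to \<open>1\<close>, so the reflection formula evaluates it.
\<close>

lemma has_mellin_cauchy_kernel: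
  fixes s :: real
  assumes s: "-1 < s" "s < 1"
  shows "has_mellin (\<lambda>x. 2 * x / (1 + x ^ 2)) s (pi / cos (pi * s / 2))"
proof (rule has_mellin_nonnegI)
  define a b where "a = (1 + s) / 2" and "b = (1 - s) / 2"
  define g :: "real \<Rightarrow> real" where "g x = x ^ 2 / (1 + x ^ 2)" for x
  define g' :: "real \<Rightarrow> real" where "g' x = 2 * x / (1 + x ^ 2) ^ 2" for x
  define f :: "real \<Rightarrow> real" where "f v = v powr (a - 1) * (1 - v) powr (b - 1)" for v
  have ab: "a > 0" "b > 0"
    using s by (auto simp: a_def b_def)
  have pos: "1 + x ^ 2 > 0" for x :: real
    by (simp add: add_pos_nonneg)
  have img: "g ` {0<..} = {0<..<1}"
  proof (intro equalityI subsetI)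
    fix y assume "y \<in> g ` {0<..}"
    then show "y \<in> {0<..<1}"
      using pos by (auto simp: g_def divide_simps)
  next
    fix y :: real assume y: "y \<in> {0<..<1}"
    then have "g (sqrt (y / (1 - y))) = y"
      by (simp add: g_def field_simps)
    moreover have "sqrt (y / (1 - y)) \<in> {0<..}"
      using y by simp
    ultimately show "y \<in> g ` {0<..}"
      by (metis image_eqI)
  qed
  have fi: "(f has_integral Beta a b) {0<..<1}"
    unfolding f_def has_integral_Icc_iff_Ioo[symmetric] using ab by (rule has_integral_Beta_real)
  then have "f absolutely_integrable_on {0<..<1}"
    by (intro nonnegative_absolutely_integrable_1) (auto simp: f_def)
  then have "f absolutely_integrable_on (g ` {0<..}) \<and> integral (g ` {0<..}) f = Beta a b"
    using fi img by (simp add: integral_unique)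
  moreover have "(g has_field_derivative g' x) (at x within {0<..})" for x
    unfolding g_def g'_def using pos[of x]
    by (auto intro!: derivative_eq_intros simp: divide_simps power2_eq_square algebra_simps)
  moreover have "inj_on g {0<..}"
  proof (rule inj_onI)
    fix x y :: real assume "x \<in> {0<..}" "y \<in> {0<..}" "g x = g y"
    then have "x ^ 2 * (1 + y ^ 2) = y ^ 2 * (1 + x ^ 2)"
      using pos[of x] pos[of y] by (simp add: g_def frac_eq_eq)
    then have "x ^ 2 = y ^ 2"
      by (simp add: algebra_simps)
    then show "x = y"
      using \<open>x \<in> {0<..}\<close> \<open>y \<in> {0<..}\<close> by (simp add: power2_eq_iff)
  qed
  ultimately have "(\<lambda>x. \<bar>g' x\<bar> * f (g x)) absolutely_integrable_on {0<..} \<and>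
      integral {0<..} (\<lambda>x. \<bar>g' x\<bar> * f (g x)) = Beta a b"
    by (subst has_absolute_integral_change_of_variables_1') auto
  then have "((\<lambda>x. \<bar>g' x\<bar> * f (g x)) has_integral Beta a b) {0<..}"
    by (metis absolutely_integrable_on_def has_integral_integral)
  moreover have "\<bar>g' x\<bar> * f (g x) = 2 * x / (1 + x ^ 2) * x powr (s - 1)" if "x > 0" for x
  proof -
    have "f (g x) = (x ^ 2) powr (a - 1) / (1 + x ^ 2) powr (a - 1) * (1 / (1 + x ^ 2)) powr (b - 1)"
      using that pos[of x] by (simp add: f_def g_def powr_divide diff_divide_distrib[symmetric] field_simps)
    also have "(x ^ 2) powr (a - 1) = x powr (s - 1)"
    proof -
      have "(x ^ 2) powr (a - 1) = x powr (2 * (a - 1))"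
        using that by (simp add: powr_powr flip: powr_numeral)
      also have "2 * (a - 1) = s - 1"
        by (simp add: a_def field_simps)
      finally show ?thesis .
    qed
    also have "(1 / (1 + x ^ 2)) powr (b - 1) = (1 + x ^ 2) powr (1 - b)"
      using pos[of x] by (simp add: powr_divide powr_minus_divide[symmetric])
    also have "x powr (s - 1) / (1 + x ^ 2) powr (a - 1) * (1 + x ^ 2) powr (1 - b) = x powr (s - 1) * (1 + x ^ 2)"
    proof -
      have "(1 + x ^ 2) powr (1 - b) / (1 + x ^ 2) powr (a - 1) = 1 + x ^ 2"
        using pos[of x] by (simp add: a_def b_def field_simps flip: powr_diff)
      then show ?thesis
        by (metis times_divide_eq_left times_divide_eq_right)
    qed
    finally show ?thesis
      using that pos[of x] by (simp add: g'_def power2_eq_square[of "1 + x ^ 2"])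
  qed
  ultimately have "((\<lambda>x. 2 * x / (1 + x ^ 2) * x powr (s - 1)) has_integral Beta a b) {0<..}"
    by (subst has_integral_cong[of _ _ "\<lambda>x. \<bar>g' x\<bar> * f (g x)"]) auto
  moreover have "Beta a b = pi / cos (pi * s / 2)"
  proof -
    have "Gamma a * Gamma (1 - a) = pi / sin (pi * a)"
      by (rule Gamma_reflection_real)
    moreover have "1 - a = b" "a + b = 1"
      by (auto simp: a_def b_def field_simps)
    moreover have "sin (pi * a) = cos (pi * s / 2)"
      by (simp add: a_def sin_add add_divide_distrib distrib_left)
    ultimately show ?thesis
      by (simp only: Beta_def Gamma_1 div_by_1)
  qed
  ultimately show "((\<lambda>x. 2 * x / (1 + x ^ 2) * x powr (s - 1)) has_integral pi / cos (pi * s / 2)) {0<..}"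
    by (simp only:)
qed auto

text \<open>
  The strip \<open>-1 < w < 0\<close> is the one where the integral converges absolutely: \<open>\<bar>sin x\<bar> \<le> x\<close> is needed
  at \<open>0\<close>, and \<open>\<bar>sin x\<bar> \<le> 1\<close> at infinity.
\<close>

lemma mellin_integrable_sin:
  assumes "-1 < w" "w < 0"
  shows "mellin_integrable sin w"
proof -
  have "has_mellin (\<lambda>x. (if x \<le> 1 then x powr 1 else 0) + (if x \<le> 1 then 0 else x powr 0)) w (1 / (1 + w) + (- 1 / (0 + w)))"
    using assms by (intro has_mellin_add has_mellin_powr_near_0 has_mellin_powr_near_infinity) auto
  then have "mellin_integrable (\<lambda>x. (if x \<le> 1 then x powr 1 else 0) + (if x \<le> 1 then 0 else x powr 0)) w"
    by (rule has_mellin_integrable)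
  then show ?thesis
  proof (rule mellin_integrable_bound[rotated])
    fix x :: real assume "x > 0"
    then have "\<bar>sin x\<bar> \<le> (if x \<le> 1 then x powr 1 else 0) + (if x \<le> 1 then 0 else x powr 0)"
      using abs_sin_x_le_abs_x[of x] abs_sin_le_one[of x] by simp
    then show "\<bar>sin x\<bar> * x powr (w - 1) \<le> \<bar>(if x \<le> 1 then x powr 1 else 0) + (if x \<le> 1 then 0 else x powr 0)\<bar> * x powr (w - 1)"
      by (intro mult_right_mono) auto
  qed measurable
qed

lemma integral_exp_mult_sin:
  fixes t :: real
  assumes t: "t > 0"
  shows "(LINT x|lborel. indicat_real {0<..} x * (exp (- (t * x)) * sin x)) = 1 / (1 + t ^ 2)"
proof -
  define c where "c = - 1 / (1 + t ^ 2)"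
  define F where "F x = c * (exp (- (t * x)) * (t * sin x + cos x))" for x
  have nz: "1 + t ^ 2 \<noteq> 0"
    by (smt (verit) zero_le_power2)
  have int: "set_integrable lborel {0<..} (\<lambda>x. exp (- (t * x)) * sin x)"
  proof -
    have "integrable lborel (\<lambda>x. indicat_real {0<..} x *\<^sub>R exp (- (x * t)))"
      using integrable_I0i_exp_mscale[OF t] by (simp add: set_integrable_def)
    then show ?thesis
      unfolding set_integrable_def
      by (rule Bochner_Integration.integrable_bound)
         (auto intro!: always_eventually simp: indicator_def abs_mult mult_ac mult_left_le)
  qed
  have "(LBINT x=0..\<infinity>. exp (- (t * x)) * sin x) = 0 - F 0"
  proof (rule interval_integral_FTC_integrable)
    show "set_integrable lborel (einterval 0 \<infinity>) (\<lambda>x. exp (- (t * x)) * sin x)"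
      using int by (simp add: zero_ereal_def)
    show "(F has_vector_derivative exp (- (t * x)) * sin x) (at x)" for x
    proof -
      have "(F has_real_derivative c * (- t * exp (- (t * x)) * (t * sin x + cos x) +
          exp (- (t * x)) * (t * cos x - sin x))) (at x)"
        unfolding F_def by (auto intro!: derivative_eq_intros simp: algebra_simps)
      also have "c * (- t * exp (- (t * x)) * (t * sin x + cos x) + exp (- (t * x)) * (t * cos x - sin x)) =
          - (c * (1 + t ^ 2)) * (exp (- (t * x)) * sin x)"
        by (simp add: algebra_simps power2_eq_square)
      also have "- (c * (1 + t ^ 2)) = 1"
        using nz by (simp add: c_def)
      finally show ?thesis
        by (simp add: has_real_derivative_iff_has_vector_derivative)
    qed
    have "isCont F 0"
      unfolding F_def by (intro continuous_intros)
    then show "((F \<circ> real_of_ereal) \<longlongrightarrow> F 0) (at_right 0)"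
      unfolding zero_ereal_def by (simp add: ereal_tendsto_simps isCont_def filterlim_at_split)
    have "(F \<longlongrightarrow> 0) at_top"
    proof (rule Lim_null_comparison)
      show "\<forall>\<^sub>F x in at_top. norm (F x) \<le> exp (- (t * x)) * (t + 1)"
      proof (intro always_eventually allI)
        fix x
        have "\<bar>t * sin x + cos x\<bar> \<le> t + 1"
          using t abs_sin_le_one[of x] abs_cos_le_one[of x]
          by (intro order.trans[OF abs_triangle_ineq] add_mono) (auto simp: abs_mult mult_left_le)
        then have "\<bar>t * sin x + cos x\<bar> / \<bar>1 + t ^ 2\<bar> \<le> t + 1"
          using t by (simp add: divide_le_eq) (smt (verit) mult_le_cancel_left1 zero_le_power2)
        then have "exp (- (t * x)) * (\<bar>t * sin x + cos x\<bar> / \<bar>1 + t ^ 2\<bar>) \<le> exp (- (t * x)) * (t + 1)"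
          by (intro mult_left_mono) auto
        then show "norm (F x) \<le> exp (- (t * x)) * (t + 1)"
          by (simp add: F_def c_def abs_mult)
      qed
      show "((\<lambda>x. exp (- (t * x)) * (t + 1)) \<longlongrightarrow> 0) at_top"
        using t by real_asymp
    qed
    then show "((F \<circ> real_of_ereal) \<longlongrightarrow> 0) (at_left \<infinity>)"
      by (simp add: ereal_tendsto_simps)
  qed (auto intro!: continuous_intros)
  then show ?thesis
    by (simp add: F_def c_def interval_lebesgue_integral_0_infty set_lebesgue_integral_def)
qed

text \<open>
  By the Gamma integral, \<open>\<Gamma>(1 - w) x powr (w - 1) = \<integral> t powr (-w) exp (-x t) dt\<close>. After insertion of
  this, Fubini's theorem reduces the integral to the Laplace transform \<open>1 / (1 + t\<^sup>2)\<close> of the sine, and then to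
  the Mellin transform of the Cauchy kernel.
\<close>

lemma has_mellin_sin:
  fixes w :: real
  assumes w: "-1 < w" "w < 0"
  shows "has_mellin sin w (Gamma w * sin (pi * w / 2))"
proof -
  define f where "f t x = (indicat_real {0<..} t * t powr - w) *
     (indicat_real {0<..} x * (exp (- (t * x)) * sin x))" for t x
  define I where "I = (LINT x|lborel. indicat_real {0<..} x * (sin x * x powr (w - 1)))"
  have sin_int: "integrable lborel (\<lambda>x. indicat_real {0<..} x * (sin x * x powr (w - 1)))"
    using mellin_integrable_sin[OF w] by (simp add: mellin_integrable_def)
  have gam: "has_bochner_integral lborel (\<lambda>t. indicat_real {0<..} t * (exp (- (x * t)) * t powr - w))
     (x powr (w - 1) * Gamma (1 - w))" if "x > 0" for x
    using has_mellin_scale[OF has_mellin_exp[of "1 - w"], of x] that w by (simp add: has_mellin_def)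
  have f_swap: "f t x = (indicat_real {0<..} x * sin x) * (indicat_real {0<..} t * (exp (- (x * t)) * t powr - w))" for t x
    by (simp add: f_def mult_ac)
  have f1: "(LINT t|lborel. f t x) = Gamma (1 - w) * (indicat_real {0<..} x * (sin x * x powr (w - 1)))" for x
  proof (cases "x > 0")
    case True
    then show ?thesis
      using gam[of x] unfolding f_swap integral_mult_right_zero by (simp add: has_bochner_integral_iff)
  qed (simp add: f_def)
  have f1abs: "(LINT t|lborel. norm (f t x)) = Gamma (1 - w) * norm (indicat_real {0<..} x * (sin x * x powr (w - 1)))" for x
  proof (cases "x > 0")
    case True
    have "norm (f t x) = (indicat_real {0<..} x * \<bar>sin x\<bar>) * (indicat_real {0<..} t * (exp (- (x * t)) * t powr - w))" for t
      by (simp add: f_swap abs_mult)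
    then show ?thesis
      using gam[of x] True by (simp add: has_bochner_integral_iff abs_mult)
  qed (simp add: f_def)
  have f2: "(LINT x|lborel. f t x) = indicat_real {0<..} t * (t powr - w / (1 + t ^ 2))" for t
    unfolding f_def integral_mult_right_zero
    by (cases "t > 0") (auto simp: integral_exp_mult_sin)
  have [measurable]: "case_prod f \<in> borel_measurable (lborel \<Otimes>\<^sub>M lborel)"
    unfolding f_def by measurable
  have "integrable (lborel \<Otimes>\<^sub>M lborel) (\<lambda>(x, t). f t x)"
  proof (rule lborel_pair.Fubini_integrable)
    show "(\<lambda>(x, t). f t x) \<in> borel_measurable (lborel \<Otimes>\<^sub>M lborel)"
      unfolding f_def by measurable
    show "integrable lborel (\<lambda>x. LINT t|lborel. norm (case (x, t) of (x, t) \<Rightarrow> f t x))"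
      using integrable_mult_right[OF integrable_norm[OF sin_int], of "Gamma (1 - w)"] by (simp add: f1abs del: real_norm_def)
    have "integrable lborel (\<lambda>t. f t x)" for x
      unfolding f_swap using gam[of x] by (cases "x > 0") (auto simp: has_bochner_integral_iff)
    then show "AE x in lborel. integrable lborel (\<lambda>t. case (x, t) of (x, t) \<Rightarrow> f t x)"
      by simp
  qed
  then have "(LINT t|lborel. LINT x|lborel. f t x) = (LINT x|lborel. LINT t|lborel. f t x)"
    by (rule lborel_pair.Fubini_integral)
  also have "\<dots> = Gamma (1 - w) * I"
    unfolding f1 I_def by (rule integral_mult_right_zero)
  finally have A: "(LINT t|lborel. indicat_real {0<..} t * (t powr - w / (1 + t ^ 2))) = Gamma (1 - w) * I"
    unfolding f2 .
  have B: "has_bochner_integral lborel (\<lambda>t. 1 / 2 * (indicat_real {0<..} t * (2 * t / (1 + t ^ 2) * t powr (- w - 1)))) (1 / 2 * (pi / cos (pi * - w / 2)))"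
    using has_mellin_cauchy_kernel[of "- w"] w unfolding has_mellin_def
    by (intro has_bochner_integral_mult_right) auto
  \<comment> \<open>Half of the Cauchy kernel with the exponent \<open>-w\<close>.\<close>
  have half: "1 / 2 * (indicat_real {0<..} t * (2 * t / (1 + t ^ 2) * t powr (- w - 1))) = indicat_real {0<..} t * (t powr - w / (1 + t ^ 2))" for t
    by (auto simp: indicator_def powr_diff)
  have "Gamma (1 - w) * I = 1 / 2 * (pi / cos (pi * - w / 2))"
    using A has_bochner_integral_integral_eq[OF B[unfolded half]] by (rule trans[OF sym])
  then have eq: "Gamma (1 - w) * I = pi / (2 * cos (pi * w / 2))"
    by simp
  note refl = Gamma_reflection_real[of w]
  have "pi * - 1 < pi * w" "pi * w < pi * 0"
    using w by (intro mult_strict_left_mono; simp)+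
  then have b: "- pi < pi * w" "pi * w < 0"
    by simp_all
  have sn: "sin (pi * w / 2) < 0"
    using sin_gt_zero[of "- (pi * w / 2)"] b by simp
  have cs: "cos (pi * w / 2) > 0"
    using b by (intro cos_gt_zero_pi) linarith+
  have sin2: "sin (pi * w) = 2 * sin (pi * w / 2) * cos (pi * w / 2)"
    using sin_double[of "pi * w / 2"] by simp
  have "Gamma (1 - w) > 0"
    using w by (intro Gamma_real_pos) auto
  moreover have "Gamma (1 - w) * I = Gamma (1 - w) * (Gamma w * sin (pi * w / 2))"
    unfolding eq using refl sn cs unfolding sin2 by (simp add: field_simps)
  ultimately have "I = Gamma w * sin (pi * w / 2)"
    by simp
  then show ?thesis
    using sin_int by (simp add: has_mellin_def has_bochner_integral_iff I_def)
qed

section \<open>The Mellin transform of the Bose kernel\<close>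

text \<open>
  The reflection formula for \<open>\<Gamma>\<close> is differentiated logarithmically. This expresses the cotangent by
  two values of the Digamma function, whose defining series are then subtracted.
\<close>

lemma cot_partial_fractions:
  fixes z :: complex
  assumes z: "z \<notin> \<int>"
  shows "(\<lambda>k. 2 * z / (of_nat (Suc k) ^ 2 - z ^ 2)) sums (1 / z - of_real pi * cot (of_real pi * z))"
proof -
  have z0: "z \<noteq> 0" and sn: "sin (of_real pi * z) \<noteq> 0"
    using z by (auto simp: sin_eq_0)
  have z1: "1 - z \<notin> \<int>"
    using Ints_diff[of 1 "1 - z"] z by auto
  have np: "z \<notin> \<int>\<^sub>\<le>\<^sub>0" "1 - z \<notin> \<int>\<^sub>\<le>\<^sub>0"
    using z z1 nonpos_Ints_subset_Ints by auto
  have "((\<lambda>z. Gamma z * Gamma (1 - z)) has_field_derivative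
      Gamma z * Gamma (1 - z) * (Digamma z - Digamma (1 - z))) (at z)"
    using np by (auto intro!: derivative_eq_intros simp: algebra_simps)
  moreover have "((\<lambda>z. Gamma z * Gamma (1 - z)) has_field_derivative
      - (of_real pi / sin (of_real pi * z) * (of_real pi * cot (of_real pi * z)))) (at z)"
    unfolding Gamma_reflection_complex using sn
    by (auto intro!: derivative_eq_intros simp: cot_def power2_eq_square field_simps)
  ultimately have "Gamma z * Gamma (1 - z) * (Digamma z - Digamma (1 - z)) =
      - (of_real pi / sin (of_real pi * z) * (of_real pi * cot (of_real pi * z)))"
    by (rule DERIV_unique)
  then have "of_real pi / sin (of_real pi * z) * (Digamma z - Digamma (1 - z)) =
      of_real pi / sin (of_real pi * z) * (- (of_real pi * cot (of_real pi * z)))"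
    by (simp only: Gamma_reflection_complex mult_minus_right)
  moreover have "of_real pi / sin (of_real pi * z) \<noteq> 0"
    using sn by simp
  ultimately have "Digamma z - Digamma (1 - z) = - (of_real pi * cot (of_real pi * z))"
    using mult_left_cancel by blast
  then have dig: "Digamma (1 - z) - Digamma z = of_real pi * cot (of_real pi * z)"
    by (metis minus_diff_eq minus_minus)
  have sums: "(\<lambda>k. inverse (of_nat (Suc k)) - inverse (w + of_nat k)) sums (Digamma w + euler_mascheroni)"
    if "w \<noteq> 0" for w :: complex
    unfolding Digamma_def using summable_sums[OF summable_Digamma[OF that]] by simp
  have "1 + z \<noteq> 0" "1 - z \<noteq> 0"
    using z z1 by (auto simp: add_eq_0_iff)
  then have "(\<lambda>k. (inverse (of_nat (Suc k)) - inverse ((1 + z) + of_nat k)) -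
      (inverse (of_nat (Suc k)) - inverse ((1 - z) + of_nat k))) sums
      ((Digamma (1 + z) + euler_mascheroni) - (Digamma (1 - z) + euler_mascheroni))"
    by (intro sums_diff sums)
  moreover have "(inverse (of_nat (Suc k)) - inverse ((1 + z) + of_nat k)) -
      (inverse (of_nat (Suc k)) - inverse ((1 - z) + of_nat k)) = 2 * z / (of_nat (Suc k) ^ 2 - z ^ 2)" for k
  proof -
    have "of_nat (Suc k) + z \<noteq> 0" "of_nat (Suc k) - z \<noteq> 0"
      using z by (metis Ints_minus Ints_of_nat add_eq_0_iff2 minus_minus, metis Ints_of_nat eq_iff_diff_eq_0)
    moreover have "(1 + z) + of_nat k = of_nat (Suc k) + z" "(1 - z) + of_nat k = of_nat (Suc k) - z"
      by auto
    moreover have "of_nat (Suc k) ^ 2 - z ^ 2 = (of_nat (Suc k) + z) * (of_nat (Suc k) - z)"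
      by (simp add: power2_eq_square algebra_simps)
    moreover have "(i - inverse a) - (i - inverse b) = (a - b) / (a * b)" if "a \<noteq> 0" "b \<noteq> 0" for i a b :: complex
      using that by (simp add: field_simps)
    moreover have "(of_nat (Suc k) + z) - (of_nat (Suc k) - z) = 2 * z"
      by simp
    ultimately show ?thesis
      by metis
  qed
  moreover have "(Digamma (1 + z) + euler_mascheroni) - (Digamma (1 - z) + euler_mascheroni) =
      1 / z - of_real pi * cot (of_real pi * z)"
    using Digamma_plus1[OF z0] dig by (simp add: add.commute algebra_simps)
  ultimately show ?thesis
    by simp
qed

text \<open>
  This is the cotangent expansion at the imaginary point \<open>\<i> x / (2 \<pi>)\<close>. The terms are written as
  dilates of the Cauchy kernel, the form in which \<open>has_mellin_series\<close> can use them.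
\<close>

lemma bose_partial_fractions:
  fixes x :: real
  assumes x: "x > 0"
  defines "c \<equiv> \<lambda>k. 1 / (2 * pi * real (Suc k))"
  shows "(\<lambda>k. c k * (2 * (c k * x) / (1 + (c k * x) ^ 2))) sums (1 / (exp x - 1) - 1 / x + 1 / 2)"
proof -
  define y where "y = x / (2 * pi)"
  have y: "y > 0"
    using x by (simp add: y_def)
  have ex: "exp x \<noteq> 1"
    using x by simp
  have "\<i> * of_real y \<notin> \<int>"
    using y by (auto elim!: Ints_cases simp: complex_eq_iff)
  from cot_partial_fractions[OF this]
  have "(\<lambda>k. Im (2 * (\<i> * of_real y) / (of_nat (Suc k) ^ 2 - (\<i> * of_real y) ^ 2))) sums
      Im (1 / (\<i> * of_real y) - of_real pi * cot (of_real pi * (\<i> * of_real y)))"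
    by (rule sums_Im)
  also have "of_real pi * (\<i> * of_real y) = \<i> * of_real (x / 2)"
    by (simp add: y_def)
  also have "cot (\<i> * of_real (x / 2)) = - \<i> * of_real ((exp x + 1) / (exp x - 1))"
  proof -
    have e: "exp (\<i> * (\<i> * of_real (x / 2))) = of_real (exp (- (x / 2)))"
      "exp (- (\<i> * (\<i> * of_real (x / 2)))) = of_real (exp (x / 2))"
      by (simp_all flip: exp_of_real mult.assoc)
    have s: "sin (\<i> * of_real (x / 2)) = of_real (exp (- (x / 2)) - exp (x / 2)) / (2 * \<i>)"
      unfolding sin_exp_eq e by simp
    have c: "cos (\<i> * of_real (x / 2)) = of_real (exp (- (x / 2)) + exp (x / 2)) / 2"
      unfolding cos_exp_eq e by simp
    have "exp (- (x / 2)) - exp (x / 2) \<noteq> 0"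
      using x by simp
    have *: "(exp (- (x / 2)) + exp (x / 2)) / (exp (- (x / 2)) - exp (x / 2)) = - ((exp x + 1) / (exp x - 1))"
    proof -
      have "exp x = exp (x / 2) * exp (x / 2)"
        by (simp flip: exp_add)
      then show ?thesis
        using ex by (simp add: exp_minus divide_simps) (simp add: algebra_simps)
    qed
    have half: "p / 2 / (q / (2 * \<i>)) = \<i> * (p / q)" for p q :: complex
      by (simp add: field_simps)
    have "cot (\<i> * of_real (x / 2)) =
        \<i> * of_real ((exp (- (x / 2)) + exp (x / 2)) / (exp (- (x / 2)) - exp (x / 2)))"
      unfolding cot_def s c half by (simp only: of_real_divide)
    then show ?thesis
      unfolding * by simp
  qed
  also have "Im (1 / (\<i> * of_real y) - of_real pi * (- \<i> * of_real ((exp x + 1) / (exp x - 1)))) =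
      - (1 / y) + pi * ((exp x + 1) / (exp x - 1))"
    using y by (simp add: Im_divide power2_eq_square)
  also have "(\<lambda>k. Im (2 * (\<i> * of_real y) / (of_nat (Suc k) ^ 2 - (\<i> * of_real y) ^ 2))) =
      (\<lambda>k. 2 * y / (real (Suc k) ^ 2 + y ^ 2))"
  proof
    fix k
    have "of_nat (Suc k) ^ 2 - (\<i> * of_real y) ^ 2 = complex_of_real (real (Suc k) ^ 2 + y ^ 2)"
      by (simp add: power_mult_distrib)
    then show "Im (2 * (\<i> * of_real y) / (of_nat (Suc k) ^ 2 - (\<i> * of_real y) ^ 2)) =
        2 * y / (real (Suc k) ^ 2 + y ^ 2)"
      by (simp only: Im_divide_of_real) simp
  qed
  finally have "(\<lambda>k. 1 / (2 * pi) * (2 * y / (real (Suc k) ^ 2 + y ^ 2))) sums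
      (1 / (2 * pi) * (- (1 / y) + pi * ((exp x + 1) / (exp x - 1))))"
    by (rule sums_mult)
  moreover have "1 / (2 * pi) * (2 * y / (real (Suc k) ^ 2 + y ^ 2)) = c k * (2 * (c k * x) / (1 + (c k * x) ^ 2))" for k
  proof -
    define N where "N = real (Suc k)"
    have N: "N > 0" "N ^ 2 + y ^ 2 > 0"
      by (auto simp: N_def intro!: add_pos_nonneg)
    have cx: "c k * x = y / N" "c k = 1 / (2 * pi) * (1 / N)"
      by (simp_all add: c_def y_def N_def del: of_nat_Suc)
    have sq: "1 + (y / N) ^ 2 = (N ^ 2 + y ^ 2) / N ^ 2"
      using N by (simp add: field_simps)
    have "1 / N * (2 * (y / N) / (D / N ^ 2)) = 2 * y / D" if "D > 0" for D
      using N that by (simp add: field_simps power2_eq_square)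
    then have "1 / N * (2 * (y / N) / ((N ^ 2 + y ^ 2) / N ^ 2)) = 2 * y / (N ^ 2 + y ^ 2)"
      using N by blast
    then show ?thesis
      unfolding cx(1) sq unfolding cx(2) N_def[symmetric] by (simp only: mult.assoc)
  qed
  moreover have "1 / (2 * pi) * (- (1 / y) + pi * ((exp x + 1) / (exp x - 1))) = 1 / (exp x - 1) - 1 / x + 1 / 2"
    using x ex by (simp add: y_def divide_simps) (simp add: algebra_simps)
  ultimately show ?thesis
    by simp
qed

definition zeta_series :: "real \<Rightarrow> real" where
  "zeta_series s = (\<Sum>k. real (Suc k) powr - s)"

lemma summable_zeta_series:
  fixes s :: real
  assumes "s > 1"
  shows "summable (\<lambda>k. real (Suc k) powr - s)"
  using assms summable_real_powr_iff[of "- s"] summable_Suc_iff[of "\<lambda>k. real k powr - s"] by simp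

lemma has_mellin_bose:
  assumes s: "s > 1"
  shows "has_mellin (\<lambda>x. 1 / (exp x - 1)) s (Gamma s * zeta_series s)"
proof -
  have sums: "(\<lambda>n. exp (- (real (Suc n) * x))) sums (1 / (exp x - 1))" if x: "x > 0" for x
  proof -
    have "(\<lambda>n. exp (- x) * exp (- x) ^ n) sums (exp (- x) * (1 / (1 - exp (- x))))"
      using x by (intro sums_mult geometric_sums) simp
    moreover have "exp (- x) * exp (- x) ^ n = exp (- (real (Suc n) * x))" for n
      by (simp add: algebra_simps flip: exp_of_nat_mult exp_add)
    moreover have "exp (- x) * (1 / (1 - exp (- x))) = 1 / (exp x - 1)"
      using x by (simp add: exp_minus divide_simps)
    ultimately show ?thesis
      by simp
  qed
  have "has_mellin (\<lambda>x. 1 / (exp x - 1)) s (Gamma s * (\<Sum>n. 1 * real (Suc n) powr - s))"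
  proof (rule has_mellin_series[OF has_mellin_exp])
    show "summable (\<lambda>n. \<bar>1\<bar> * real (Suc n) powr - s)"
      using summable_zeta_series[OF s] by simp
  qed (use s sums in \<open>auto simp: sums_iff\<close>)
  then show ?thesis
    by (simp add: zeta_series_def)
qed

lemma has_mellin_bose_regularised:
  assumes s: "-1 < s" "s < 0"
  shows "has_mellin (\<lambda>x. 1 / (exp x - 1) - 1 / x + 1 / 2) s
    (pi / cos (pi * s / 2) * ((2 * pi) powr (s - 1) * zeta_series (1 - s)))"
proof -
  define c where "c k = 1 / (2 * pi * real (Suc k))" for k
  have c: "c k > 0" for k
    by (simp add: c_def)
  have eq: "c k * c k powr - s = (2 * pi) powr (s - 1) * real (Suc k) powr - (1 - s)" for k
  proof -
    have "c k * c k powr - s = c k powr (1 - s)"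
      using c[of k] powr_mult_base[of "c k" "- s"] by simp
    also have "\<dots> = (2 * pi) powr - (1 - s) * real (Suc k) powr - (1 - s)"
    proof -
      have "c k = (2 * pi * real (Suc k)) powr - 1"
        unfolding c_def by (subst powr_minus_divide) (simp del: of_nat_Suc)
      then have "c k powr (1 - s) = (2 * pi * real (Suc k)) powr (- 1 * (1 - s))"
        by (simp only: powr_powr)
      also have "- 1 * (1 - s) = - (1 - s)"
        by simp
      finally show ?thesis
        by (simp only: powr_mult)
    qed
    finally show ?thesis
      by simp
  qed
  have sm: "summable (\<lambda>k. real (Suc k) powr - (1 - s))"
    using s by (intro summable_zeta_series) auto
  have "has_mellin (\<lambda>x. 1 / (exp x - 1) - 1 / x + 1 / 2) s (pi / cos (pi * s / 2) * (\<Sum>k. c k * c k powr - s))"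
  proof (rule has_mellin_series[OF has_mellin_cauchy_kernel])
    show "summable (\<lambda>k. \<bar>c k\<bar> * c k powr - s)"
      using summable_mult[OF sm, of "(2 * pi) powr (s - 1)"] c by (simp add: eq abs_of_pos)
    fix x :: real assume x: "x > 0"
    note * = bose_partial_fractions[OF x, folded c_def]
    have "\<bar>c k * (2 * (c k * x) / (1 + (c k * x) ^ 2))\<bar> = c k * (2 * (c k * x) / (1 + (c k * x) ^ 2))" for k
      using c[of k] x by (simp add: add_pos_nonneg)
    then show "summable (\<lambda>k. \<bar>c k * (2 * (c k * x) / (1 + (c k * x) ^ 2))\<bar>)"
      using * by (simp only: sums_summable)
    show "1 / (exp x - 1) - 1 / x + 1 / 2 = (\<Sum>k. c k * (2 * (c k * x) / (1 + (c k * x) ^ 2)))"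
      using * by (simp add: sums_iff)
  qed (use s c in auto)
  also have "(\<Sum>k. c k * c k powr - s) = (2 * pi) powr (s - 1) * zeta_series (1 - s)"
    unfolding eq zeta_series_def by (rule suminf_mult[OF sm])
  finally show ?thesis .
qed

section \<open>The zeta function and its functional equation\<close>

lemma mellin_holomorphic_right:
  assumes "f \<in> borel_measurable borel" and "\<And>\<sigma>. A < \<sigma> \<Longrightarrow> mellin_integrable f \<sigma>"
  shows "mellin f holomorphic_on {s. A < Re s}"
proof -
  have "mellin f field_differentiable at s" if "A < Re s" for s
  proof -
    have "mellin f holomorphic_on {z. A < Re z \<and> Re z < Re s + 1}"
      using assms by (intro mellin_holomorphic) auto
    then show ?thesis
      using that by (intro holomorphic_on_imp_differentiable_at[OF _ open_strip]) auto
  qed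
  then show ?thesis
    by (auto simp: holomorphic_on_def intro: field_differentiable_at_within)
qed

text \<open>
  The polar part \<open>1/x - 1/2\<close> is removed on \<open>(0, 1]\<close> only, so that the decay at infinity is kept.
  The Mellin transform then exists for all exponents greater than \<open>-1\<close>.
\<close>

definition bose_kernel :: "real \<Rightarrow> real" where
  "bose_kernel x = (if x \<le> 1 then 1 / (exp x - 1) - 1 / x + 1 / 2 else 1 / (exp x - 1))"

lemma borel_measurable_bose_kernel [measurable]: "bose_kernel \<in> borel_measurable borel"
  unfolding bose_kernel_def[abs_def] by measurable

text \<open>
  Integrability near \<open>0\<close> only improves when the exponent grows, and near infinity when it decreases. So both
  halves inherit it from the strips in which the transforms over \<open>(0, \<infinity>)\<close> have been computed.
\<close>

lemma mellin_integrable_bose_kernel: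
  assumes "-1 < \<sigma>"
  shows "mellin_integrable bose_kernel \<sigma>"
proof -
  \<comment> \<open>An exponent in the strip \<open>-1 < \<tau> < 0\<close> not exceeding \<open>\<sigma>\<close>.\<close>
  define \<tau> where "\<tau> = min \<sigma> (- 1 / 2)"
  have "mellin_integrable (\<lambda>x. 1 / (exp x - 1) - 1 / x + 1 / 2) \<tau>"
    using assms by (intro has_mellin_integrable[OF has_mellin_bose_regularised]) (auto simp: \<tau>_def)
  then have "mellin_integrable (\<lambda>x. if x \<le> 1 then 1 / (exp x - 1) - 1 / x + 1 / 2 else 0) \<sigma>"
    by (rule mellin_integrable_near_0[rotated]) (auto simp: \<tau>_def)
  moreover have "mellin_integrable (\<lambda>x. 1 / (exp x - 1)) (max \<sigma> 2)"
    by (rule has_mellin_integrable[OF has_mellin_bose]) auto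
  then have "mellin_integrable (\<lambda>x. if x \<le> 1 then 0 else 1 / (exp x - 1)) \<sigma>"
    by (rule mellin_integrable_near_infinity[rotated]) auto
  ultimately obtain u v where
    "has_mellin (\<lambda>x. if x \<le> 1 then 1 / (exp x - 1) - 1 / x + 1 / 2 else 0) \<sigma> u"
    "has_mellin (\<lambda>x. if x \<le> 1 then 0 else 1 / (exp x - 1)) \<sigma> v"
    using mellin_integrableD by blast
  then have "has_mellin (\<lambda>x. (if x \<le> 1 then 1 / (exp x - 1) - 1 / x + 1 / 2 else 0) +
      (if x \<le> 1 then 0 else 1 / (exp x - 1))) \<sigma> (u + v)"
    by (rule has_mellin_add)
  also have "?this \<longleftrightarrow> has_mellin bose_kernel \<sigma> (u + v)"
    by (intro has_mellin_cong) (auto simp: bose_kernel_def)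
  finally show ?thesis
    by (rule has_mellin_integrable)
qed

text \<open>
  Here \<open>1 / (s - 1)\<close> and \<open>-1 / (2 s)\<close> are the Mellin transforms over \<open>(0, 1]\<close> of the removed terms \<open>1/x\<close>
  and \<open>-1/2\<close>. The second one is combined with \<open>1 / \<Gamma>(s)\<close> into \<open>1 / \<Gamma>(s + 1)\<close>, which leaves \<open>1\<close> as
  the only singularity for \<open>Re s > -1\<close>.
\<close>

definition zeta_right :: "complex \<Rightarrow> complex" where
  "zeta_right s = rGamma s * (mellin bose_kernel s + 1 / (s - 1)) - rGamma (s + 1) / 2"

lemma zeta_right_holomorphic: "zeta_right holomorphic_on ({s. -1 < Re s} - {1})"
proof -
  have "mellin bose_kernel holomorphic_on ({s. -1 < Re s} - {1})"
    by (rule holomorphic_on_subset[OF mellin_holomorphic_right[of _ "-1"]])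
       (auto intro: mellin_integrable_bose_kernel)
  then show ?thesis
    unfolding zeta_right_def[abs_def] by (intro holomorphic_intros) auto
qed

lemma zeta_right_0: "zeta_right 0 = - 1 / 2"
  by (simp add: zeta_right_def)

lemma rGamma_half_pole:
  fixes s :: complex
  assumes "s \<noteq> 0"
  shows "rGamma (s + 1) / 2 = rGamma s * (1 / (2 * s))"
  using rGamma_plus1[of s] assms by (simp add: field_simps)

lemma zeta_right_of_real_gt_1:
  assumes s: "s > 1"
  shows "zeta_right (of_real s) = of_real (zeta_series s)"
proof -
  have "has_mellin (\<lambda>x. 1 / (exp x - 1) + (- 1 * (if x \<le> 1 then x powr - 1 else 0) +
      1 / 2 * (if x \<le> 1 then x powr 0 else 0))) s
      (Gamma s * zeta_series s + (- 1 * (1 / (- 1 + s)) + 1 / 2 * (1 / (0 + s))))"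
    using s by (intro has_mellin_add has_mellin_cmult has_mellin_powr_near_0 has_mellin_bose) auto
  also have "?this \<longleftrightarrow> has_mellin bose_kernel s
      (Gamma s * zeta_series s + (- 1 * (1 / (- 1 + s)) + 1 / 2 * (1 / (0 + s))))"
    by (intro has_mellin_cong) (simp add: bose_kernel_def powr_minus_divide)
  finally have "mellin bose_kernel (of_real s) =
      of_real (Gamma s * zeta_series s + (- 1 * (1 / (- 1 + s)) + 1 / 2 * (1 / (0 + s))))"
    by (rule mellin_of_real)
  then have "mellin bose_kernel (of_real s) + 1 / (of_real s - 1) - 1 / (2 * of_real s) = Gamma (of_real s) * of_real (zeta_series s)"
    by (simp add: Gamma_complex_of_real algebra_simps)
  moreover have "zeta_right (of_real s) =
      rGamma (of_real s) * (mellin bose_kernel (of_real s) + 1 / (of_real s - 1) - 1 / (2 * of_real s))"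
    using s rGamma_half_pole[of "of_real s"] by (simp add: zeta_right_def algebra_simps)
  moreover have "rGamma (of_real s) * Gamma (of_real s :: complex) = 1"
  proof -
    have "(of_real s :: complex) \<notin> \<int>\<^sub>\<le>\<^sub>0"
      using s by (auto elim!: nonpos_Ints_cases simp: complex_eq_iff)
    then show ?thesis
      by (simp add: rGamma_inverse_Gamma Gamma_eq_zero_iff)
  qed
  ultimately show ?thesis
    by simp
qed

text \<open>
  For \<open>-1 < s < 0\<close> the functions \<open>1/x\<close> and \<open>1/2\<close> have Mellin transforms over \<open>(1, \<infinity>)\<close> which are exactly the
  negatives of the continued ones over \<open>(0, 1]\<close>. So the correction terms complete the kernel to
  \<open>1 / (exp x - 1) - 1/x + 1/2\<close> on the whole half-line, whose transform is known.
\<close>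

lemma zeta_right_of_real_negative:
  assumes s: "-1 < s" "s < 0"
  shows "zeta_right (of_real s) =
    of_real (2 * (2 * pi) powr (s - 1) * sin (pi * s / 2) * Gamma (1 - s) * zeta_series (1 - s))"
proof -
  define V where "V = pi / cos (pi * s / 2) * ((2 * pi) powr (s - 1) * zeta_series (1 - s))"
  have "has_mellin (\<lambda>x. (1 / (exp x - 1) - 1 / x + 1 / 2) + (1 * (if x \<le> 1 then 0 else x powr - 1) +
      (- 1 / 2) * (if x \<le> 1 then 0 else x powr 0))) s
      (V + (1 * (- 1 / (- 1 + s)) + (- 1 / 2) * (- 1 / (0 + s))))"
    unfolding V_def
    using s by (intro has_mellin_add has_mellin_cmult has_mellin_powr_near_infinity has_mellin_bose_regularised) auto
  also have "?this \<longleftrightarrow> has_mellin bose_kernel s (V + (1 * (- 1 / (- 1 + s)) + (- 1 / 2) * (- 1 / (0 + s))))"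
    by (intro has_mellin_cong) (simp add: bose_kernel_def powr_minus_divide)
  finally have "mellin bose_kernel (of_real s) = of_real (V + (1 * (- 1 / (- 1 + s)) + (- 1 / 2) * (- 1 / (0 + s))))"
    by (rule mellin_of_real)
  also have "V + (1 * (- 1 / (- 1 + s)) + (- 1 / 2) * (- 1 / (0 + s))) = V - 1 / (s - 1) + 1 / (2 * s)"
    by simp
  finally have "mellin bose_kernel (of_real s) = of_real V - 1 / (of_real s - 1) + 1 / (2 * of_real s)"
    by (simp only: of_real_add of_real_diff of_real_divide of_real_mult of_real_1 of_real_numeral)
  moreover have "zeta_right (of_real s) =
      rGamma (of_real s) * (mellin bose_kernel (of_real s) + 1 / (of_real s - 1) - 1 / (2 * of_real s))"
    using s rGamma_half_pole[of "of_real s"] by (simp add: zeta_right_def algebra_simps)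
  ultimately have "zeta_right (of_real s) = rGamma (of_real s) * of_real V"
    by simp
  also have "rGamma (of_real s :: complex) = of_real (rGamma s)"
    by (rule rGamma_complex_of_real)
  also have "rGamma s = Gamma (1 - s) * sin (pi * s) / pi"
  proof -
    have "Gamma (1 - s) > 0"
      using s by (intro Gamma_real_pos) auto
    moreover have "sin (pi * s) \<noteq> 0"
    proof -
      have "pi * - 1 < pi * s" "pi * s < pi * 0"
        using s by (intro mult_strict_left_mono; simp)+
      then show ?thesis
        using sin_zero_pi_iff[of "pi * s"] s by (simp add: abs_less_iff)
    qed
    ultimately show ?thesis
      using Gamma_reflection_real[of s] by (auto simp: rGamma_inverse_Gamma divide_simps mult_ac)
  qed
  also have "sin (pi * s) = 2 * sin (pi * s / 2) * cos (pi * s / 2)"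
    using sin_double[of "pi * s / 2"] by simp
  finally have "zeta_right (of_real s) = of_real (Gamma (1 - s) * (2 * sin (pi * s / 2) * cos (pi * s / 2)) / pi * V)"
    by simp
  also have "Gamma (1 - s) * (2 * sin (pi * s / 2) * cos (pi * s / 2)) / pi * V =
     2 * (2 * pi) powr (s - 1) * sin (pi * s / 2) * Gamma (1 - s) * zeta_series (1 - s)"
  proof -
    have "pi * - 1 < pi * s" "pi * s < pi * 0"
      using s by (intro mult_strict_left_mono; simp)+
    then have "cos (pi * s / 2) > 0"
      by (intro cos_gt_zero_pi) linarith+
    then show ?thesis
      by (simp add: V_def)
  qed
  finally show ?thesis .
qed

text \<open>
  For \<open>0 < s < 1\<close> the correction terms amount to \<open>\<Gamma>(s) \<zeta>(s) = \<integral> (1 / (exp x - 1) - 1/x) x powr (s - 1) dx\<close> over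
  \<open>(0, \<infinity>)\<close>, and the integrand is negative. In the proof this is phrased as an upper bound for the transform of
  the kernel; the bound \<open>2/3\<close> times \<open>1/x\<close> for \<open>x > 1\<close> makes the inequality strict.
\<close>

lemma zeta_right_of_real_nonzero:
  assumes s: "0 < s" "s < 1"
  shows "zeta_right (of_real s) \<noteq> 0"
proof -
  obtain v where v: "has_mellin bose_kernel s v"
    using mellin_integrable_bose_kernel[of s] s mellin_integrableD by force
  have B: "has_mellin (\<lambda>x. 1 / 2 * (if x \<le> 1 then x powr 0 else 0) + 2 / 3 * (if x \<le> 1 then 0 else x powr - 1)) s
      (1 / 2 * (1 / (0 + s)) + 2 / 3 * (- 1 / (- 1 + s)))"
    using s by (intro has_mellin_add has_mellin_cmult has_mellin_powr_near_0 has_mellin_powr_near_infinity) auto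
  have "bose_kernel x \<le> 1 / 2 * (if x \<le> 1 then x powr 0 else 0) + 2 / 3 * (if x \<le> 1 then 0 else x powr - 1)"
    if x: "x > 0" for x
  proof -
    have e: "exp x - 1 \<ge> x + x ^ 2 / 2"
      using exp_lower_Taylor_quadratic[of x] x by simp
    show ?thesis
    proof (cases "x \<le> 1")
      case True
      have "1 / (exp x - 1) \<le> 1 / x"
        using e x by (intro divide_left_mono mult_pos_pos) (auto intro: order.trans[rotated])
      then show ?thesis
        using True x by (simp add: bose_kernel_def)
    next
      case False
      have "3 / 2 * x \<le> exp x - 1"
      proof -
        have "x * 1 \<le> x * x"
          using False x by (intro mult_left_mono) auto
        then show ?thesis
          using e by (simp add: power2_eq_square)
      qed
      then have "1 / (exp x - 1) \<le> 1 / (3 / 2 * x)"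
        using x by (intro divide_left_mono mult_pos_pos) auto
      then show ?thesis
        using False x by (simp add: bose_kernel_def powr_minus_divide)
    qed
  qed
  note bound = this
  define g where "g x = 1 / 2 * (if x \<le> 1 then x powr 0 else 0) + 2 / 3 * (if x \<le> 1 then 0 else x powr - 1)" for x :: real
  have "indicat_real {0<..} x * (bose_kernel x * x powr (s - 1)) \<le> indicat_real {0<..} x * (g x * x powr (s - 1))" for x
  proof (cases "x > 0")
    case True
    then show ?thesis
      using mult_right_mono[OF bound[OF True, folded g_def], of "x powr (s - 1)"] by simp
  qed simp
  then have "(LINT x|lborel. indicat_real {0<..} x * (bose_kernel x * x powr (s - 1))) \<le>
      (LINT x|lborel. indicat_real {0<..} x * (g x * x powr (s - 1)))"
    using has_mellin_integrable[OF v] has_mellin_integrable[OF B, folded g_def]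
    unfolding mellin_integrable_def by (intro integral_mono)
  then have "v \<le> 1 / 2 * (1 / (0 + s)) + 2 / 3 * (- 1 / (- 1 + s))"
    using v B[folded g_def] unfolding has_mellin_def by (simp only: has_bochner_integral_integral_eq)
  moreover have "- 1 / (- 1 + s) = 1 / (1 - s)"
    by (simp add: divide_simps)
  moreover have "1 / (s - 1) = - (1 / (1 - s))"
    by (simp add: divide_simps)
  moreover have "1 / (1 - s) > 0" "1 / (2 * s) = 1 / 2 * (1 / s)"
    using s by auto
  ultimately have neg: "v + 1 / (s - 1) - 1 / (2 * s) < 0"
    by (simp only: add_0_left)
  have "mellin bose_kernel (of_real s) = of_real v"
    by (rule mellin_of_real[OF v])
  moreover have "zeta_right (of_real s) =
      rGamma (of_real s) * (mellin bose_kernel (of_real s) + 1 / (of_real s - 1) - 1 / (2 * of_real s))"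
    using s rGamma_half_pole[of "of_real s"] by (simp add: zeta_right_def algebra_simps)
  ultimately have "zeta_right (of_real s) = of_real (rGamma s * (v + 1 / (s - 1) - 1 / (2 * s)))"
    by (simp add: rGamma_complex_of_real)
  moreover have "rGamma s \<noteq> 0"
    using Gamma_real_pos[OF s(1)] by (simp add: rGamma_inverse_Gamma less_imp_neq[symmetric])
  moreover have "v + 1 / (s - 1) - 1 / (2 * s) \<noteq> 0"
    using neg by (rule less_imp_neq)
  ultimately show ?thesis
    by (simp only: of_real_eq_0_iff mult_eq_0_iff simp_thms)
qed

definition dirichlet_zeta :: "complex \<Rightarrow> complex" where
  "dirichlet_zeta s = (\<Sum>k. 1 / of_nat (Suc k) powr s)"

lemma powr_neg_nat_eq_exp:
  fixes s :: complex
  shows "1 / of_nat (Suc k) powr s = exp (s * of_real (- ln (real (Suc k))))"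
  by (simp add: powr_def Ln_of_nat exp_minus divide_inverse del: of_nat_Suc)

lemma norm_powr_neg_nat:
  "norm (1 / of_nat (Suc k) powr s :: complex) = real (Suc k) powr - Re s"
  unfolding powr_neg_nat_eq_exp norm_exp_eq_Re by (simp add: powr_def del: of_nat_Suc)

lemma powr_neg_nat_of_real:
  "1 / of_nat (Suc k) powr of_real s = complex_of_real (real (Suc k) powr - s)"
  unfolding powr_neg_nat_eq_exp by (simp add: powr_def del: of_nat_Suc flip: exp_of_real)

lemma summable_norm_dirichlet_zeta:
  assumes "Re s > 1"
  shows "summable (\<lambda>k. norm (1 / of_nat (Suc k) powr s :: complex))"
  unfolding norm_powr_neg_nat by (rule summable_zeta_series[OF assms])

lemma dirichlet_zeta_sums:
  assumes "Re s > 1"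
  shows "(\<lambda>k. 1 / of_nat (Suc k) powr s) sums dirichlet_zeta s"
  unfolding dirichlet_zeta_def
  using summable_norm_cancel[OF summable_norm_dirichlet_zeta[OF assms]] by (rule summable_sums)

lemma dirichlet_zeta_of_real:
  assumes "s > 1"
  shows "dirichlet_zeta (of_real s) = of_real (zeta_series s)"
  unfolding dirichlet_zeta_def zeta_series_def powr_neg_nat_of_real
  by (rule suminf_of_real[OF summable_zeta_series[OF assms], symmetric])

lemma dirichlet_zeta_holomorphic: "dirichlet_zeta holomorphic_on {s. 1 < Re s}"
proof -
  have "dirichlet_zeta field_differentiable at s" if s: "1 < Re s" for s
  proof -
    let ?L = "\<lambda>k. - ln (real (Suc k))"
    have "(\<lambda>s. LINT k|count_space UNIV. 1 * exp (s * of_real (?L k))) holomorphic_on {z. 1 < Re z \<and> Re z < Re s + 1}"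
    proof (rule exp_integral_holomorphic)
      fix t :: real assume "1 < t"
      then show "integrable (count_space UNIV) (\<lambda>k. norm (1 :: complex) * exp (t * ?L k))"
        using summable_zeta_series[of t] unfolding integrable_count_space_nat_iff
        by (simp add: powr_def del: of_nat_Suc)
    qed auto
    also have "?this \<longleftrightarrow> dirichlet_zeta holomorphic_on {z. 1 < Re z \<and> Re z < Re s + 1}"
    proof (rule holomorphic_cong[OF refl])
      fix z assume "z \<in> {z. 1 < Re z \<and> Re z < Re s + 1}"
      then have "integrable (count_space UNIV) (\<lambda>k. exp (z * of_real (?L k)))"
        using summable_norm_dirichlet_zeta[of z] unfolding integrable_count_space_nat_iff powr_neg_nat_eq_exp by simp
      then show "(LINT k|count_space UNIV. 1 * exp (z * of_real (?L k))) = dirichlet_zeta z"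
        unfolding dirichlet_zeta_def powr_neg_nat_eq_exp mult_1 by (rule integral_count_space_nat)
    qed
    finally show ?thesis
      using s by (intro holomorphic_on_imp_differentiable_at[OF _ open_strip]) auto
  qed
  then show ?thesis
    by (auto simp: holomorphic_on_def intro: field_differentiable_at_within)
qed

lemma zeta_right_eq_dirichlet_zeta:
  assumes "Re s > 1"
  shows "zeta_right s = dirichlet_zeta s"
proof (rule holomorphic_eq_if_eq_on_real_interval[where f = zeta_right and g = dirichlet_zeta and S = "{s. 1 < Re s}" and a = 1 and b = 2])
  show "zeta_right holomorphic_on {s. 1 < Re s}"
    by (rule holomorphic_on_subset[OF zeta_right_holomorphic]) auto
  show "connected {s. 1 < Re s}"
    by (rule convex_connected[OF convex_halfspace_Re_gt])
qed (use assms in \<open>auto simp: dirichlet_zeta_holomorphic open_halfspace_Re_gt zeta_right_of_real_gt_1 dirichlet_zeta_of_real\<close>)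

text \<open>
  The factor of the functional equation \<open>\<zeta>(s) = 2 (2 \<pi>) powr (s - 1) sin (\<pi> s / 2) \<Gamma>(1 - s) \<zeta>(1 - s)\<close>.
\<close>

definition zeta_reflected :: "complex \<Rightarrow> complex" where
  "zeta_reflected s = 2 * of_real (2 * pi) powr (s - 1) * sin (of_real pi * s / 2) * Gamma (1 - s)"

lemma Re_pos_not_nonpos_Int: "Re z > 0 \<Longrightarrow> z \<notin> \<int>\<^sub>\<le>\<^sub>0"
  by (auto elim!: nonpos_Ints_cases)

lemma zeta_reflected_holomorphic: "zeta_reflected holomorphic_on {s. Re s < 1}"
  unfolding zeta_reflected_def[abs_def]
  by (intro holomorphic_intros) (simp_all add: Re_pos_not_nonpos_Int)

lemma zeta_right_reflection_left:
  assumes s: "-1 < Re s" "Re s < 0"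
  shows "zeta_right s = zeta_reflected s * dirichlet_zeta (1 - s)"
proof (rule holomorphic_eq_if_eq_on_real_interval[where S = "{s. -1 < Re s \<and> Re s < 0}" and a = "-1" and b = 0
    and g = "\<lambda>s. zeta_reflected s * dirichlet_zeta (1 - s)"])
  show "zeta_right holomorphic_on {s. -1 < Re s \<and> Re s < 0}"
    by (rule holomorphic_on_subset[OF zeta_right_holomorphic]) auto
  have "(\<lambda>s. dirichlet_zeta (1 - s)) holomorphic_on {s. -1 < Re s \<and> Re s < 0}"
    by (rule holomorphic_on_compose_gen[OF _ dirichlet_zeta_holomorphic, unfolded comp_def])
       (auto intro!: holomorphic_intros)
  moreover have "zeta_reflected holomorphic_on {s. -1 < Re s \<and> Re s < 0}"
    by (rule holomorphic_on_subset[OF zeta_reflected_holomorphic]) auto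
  ultimately show "(\<lambda>s. zeta_reflected s * dirichlet_zeta (1 - s)) holomorphic_on {s. -1 < Re s \<and> Re s < 0}"
    by (intro holomorphic_on_mult)
  show "zeta_right (of_real t) = zeta_reflected (of_real t) * dirichlet_zeta (1 - of_real t)"
    if t: "-1 < t" "t < 0" for t
  proof -
    have "dirichlet_zeta (1 - of_real t) = of_real (zeta_series (1 - t))"
      using dirichlet_zeta_of_real[of "1 - t"] t by simp
    moreover have "zeta_reflected (of_real t) = of_real (2 * (2 * pi) powr (t - 1) * sin (pi * t / 2) * Gamma (1 - t))"
    proof -
      have "Gamma (1 - of_real t) = complex_of_real (Gamma (1 - t))"
        by (metis Gamma_complex_of_real of_real_1 of_real_diff)
      moreover have "of_real (2 * pi) powr (of_real t - 1) = complex_of_real ((2 * pi) powr (t - 1))"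
        using powr_of_real[of "2 * pi" "t - 1"] by simp
      moreover have "sin (of_real pi * of_real t / 2) = complex_of_real (sin (pi * t / 2))"
        using sin_of_real[of "pi * t / 2", where 'a = complex] by simp
      ultimately show ?thesis
        by (simp only: zeta_reflected_def of_real_mult of_real_numeral)
    qed
    ultimately show ?thesis
      by (simp only: zeta_right_of_real_negative[OF t] of_real_mult)
  qed
qed (use s in \<open>auto simp: open_strip connected_strip\<close>)

text \<open>
  For \<open>Re s < 0\<close> the right-hand side of the functional equation involves only the Dirichlet series. It thus
  serves as a definition there, consistent with \<open>zeta_right\<close> on the overlap \<open>-1 < Re s < 0\<close>.
\<close>

definition zeta_glued :: "complex \<Rightarrow> complex" where
  "zeta_glued s = (if Re s > -1 then zeta_right s else zeta_reflected s * dirichlet_zeta (1 - s))"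

lemma zeta_glued_left:
  assumes "Re s < 0"
  shows "zeta_glued s = zeta_reflected s * dirichlet_zeta (1 - s)"
  using assms zeta_right_reflection_left by (simp add: zeta_glued_def)

lemma is_zeta_continuation_zeta_glued: "is_zeta_continuation zeta_glued"
proof -
  have 1: "zeta_glued holomorphic_on ({s. -1 < Re s} - {1})"
    using zeta_right_holomorphic
    by (rule holomorphic_transform) (auto simp: zeta_glued_def)
  have "(\<lambda>s. dirichlet_zeta (1 - s)) holomorphic_on {s. Re s < 0}"
    by (rule holomorphic_on_compose_gen[OF _ dirichlet_zeta_holomorphic, unfolded comp_def])
       (auto intro!: holomorphic_intros)
  moreover have "zeta_reflected holomorphic_on {s. Re s < 0}"
    by (rule holomorphic_on_subset[OF zeta_reflected_holomorphic]) auto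
  ultimately have "(\<lambda>s. zeta_reflected s * dirichlet_zeta (1 - s)) holomorphic_on {s. Re s < 0}"
    by (intro holomorphic_on_mult)
  then have 2: "zeta_glued holomorphic_on {s. Re s < 0}"
    by (rule holomorphic_transform) (simp add: zeta_glued_left)
  have "zeta_glued holomorphic_on (({s. -1 < Re s} - {1}) \<union> {s. Re s < 0})"
    by (intro holomorphic_on_Un 1 2 open_Diff open_halfspace_Re_gt open_halfspace_Re_lt) auto
  also have "({s. -1 < Re s} - {1}) \<union> {s. Re s < 0} = - {1}"
    by auto
  finally have "zeta_glued holomorphic_on - {1}" .
  moreover have "zeta_glued s = dirichlet_zeta s" if "Re s > 1" for s
    using that by (simp add: zeta_glued_def zeta_right_eq_dirichlet_zeta)
  ultimately show ?thesis
    unfolding is_zeta_continuation_def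
    using dirichlet_zeta_sums by simp
qed

lemma is_zeta_continuation_riemann_zeta: "is_zeta_continuation riemann_zeta"
  unfolding riemann_zeta_def by (rule someI[of _ zeta_glued]) (rule is_zeta_continuation_zeta_glued)

lemma riemann_zeta_holomorphic: "riemann_zeta holomorphic_on - {1}"
  using is_zeta_continuation_riemann_zeta by (simp add: is_zeta_continuation_def)

lemma riemann_zeta_eq_glued: "s \<noteq> 1 \<Longrightarrow> riemann_zeta s = zeta_glued s"
  by (rule is_zeta_continuation_unique[OF is_zeta_continuation_riemann_zeta is_zeta_continuation_zeta_glued])

lemma riemann_zeta_eq_right: "s \<noteq> 1 \<Longrightarrow> Re s > -1 \<Longrightarrow> riemann_zeta s = zeta_right s"
  by (simp add: riemann_zeta_eq_glued zeta_glued_def)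

lemma riemann_zeta_eq_dirichlet_zeta: "Re s > 1 \<Longrightarrow> riemann_zeta s = dirichlet_zeta s"
  by (subst riemann_zeta_eq_right) (auto simp: zeta_right_eq_dirichlet_zeta)

text \<open>
  The equation holds for \<open>Re s < 0\<close> by construction. It extends to \<open>0 \<le> Re s < 1\<close> by analytic continuation in a strip
  from which the point \<open>0\<close> is removed, as it is mirrored to the pole.
\<close>

theorem riemann_zeta_functional_equation:
  assumes s: "Re s < 1" "s \<noteq> 0"
  shows "riemann_zeta s = zeta_reflected s * riemann_zeta (1 - s)"
proof (cases "Re s < 0")
  case True
  then show ?thesis
    by (subst riemann_zeta_eq_glued) (auto simp: zeta_glued_left riemann_zeta_eq_dirichlet_zeta)
next
  case False
  let ?S = "{s. -1 < Re s \<and> Re s < 1} - {0}"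
  show ?thesis
  proof (rule holomorphic_eq_if_eq_on_real_interval[where S = ?S and a = "-1" and b = 0
      and g = "\<lambda>s. zeta_reflected s * riemann_zeta (1 - s)"])
    show "riemann_zeta holomorphic_on ?S"
      by (rule holomorphic_on_subset[OF riemann_zeta_holomorphic]) auto
    have "(\<lambda>s. riemann_zeta (1 - s)) holomorphic_on ?S"
      by (rule holomorphic_on_compose_gen[OF _ riemann_zeta_holomorphic, unfolded comp_def])
         (auto intro!: holomorphic_intros)
    moreover have "zeta_reflected holomorphic_on ?S"
      by (rule holomorphic_on_subset[OF zeta_reflected_holomorphic]) auto
    ultimately show "(\<lambda>s. zeta_reflected s * riemann_zeta (1 - s)) holomorphic_on ?S"
      by (intro holomorphic_on_mult)
    show "open ?S"
      by (intro open_Diff open_strip) auto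
    show "connected ?S"
      by (intro connected_open_delete open_strip connected_strip) simp
    show "riemann_zeta (of_real t) = zeta_reflected (of_real t) * riemann_zeta (1 - of_real t)"
      if "-1 < t" "t < 0" for t
      using that by (subst riemann_zeta_eq_glued) (auto simp: zeta_glued_left riemann_zeta_eq_dirichlet_zeta)
  qed (use s False in auto)
qed

section \<open>The Dirichlet series of the Liouville function\<close>

lemma sum_divisors_coprime_mult:
  fixes f :: "nat \<Rightarrow> 'a :: comm_monoid_add"
  assumes ab: "coprime a b"
  shows "(\<Sum>d | d dvd a * b. f d) = (\<Sum>x | x dvd a. \<Sum>y | y dvd b. f (x * y))"
proof -
  \<comment> \<open>A divisor of \<open>a * b\<close> splits into its parts dividing \<open>a\<close> and \<open>b\<close> in exactly one way.\<close>
  have inj: "inj_on (\<lambda>(x, y). x * y) ({x. x dvd a} \<times> {y. y dvd b})"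
  proof (rule inj_onI, clarify)
    fix x y x' y' assume d: "x dvd a" "y dvd b" "x' dvd a" "y' dvd b" and eq: "x * y = x' * y'"
    have *: "u dvd u'" if "u dvd a" "v' dvd b" "u * v = u' * v'" for u v u' v' :: nat
    proof -
      have "coprime u v'"
        using ab that(1,2) by (meson coprime_divisors)
      moreover have "u dvd u' * v'"
        using that(3) by (metis dvd_triv_left)
      ultimately show ?thesis
        by (simp add: coprime_dvd_mult_left_iff)
    qed
    have "x = x'"
      using *[of x y' y x'] *[of x' y y' x] d eq by (simp add: dvd_antisym)
    have **: "v dvd v'" if "v dvd b" "u' dvd a" "u * v = u' * v'" for u v u' v' :: nat
    proof -
      have "coprime v u'"
        using ab that(1,2) by (meson coprime_divisors coprime_commute)
      moreover have "v dvd u' * v'"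
        using that(3) by (metis dvd_triv_right)
      ultimately show ?thesis
        by (simp add: coprime_dvd_mult_right_iff)
    qed
    have "y = y'"
      using **[of y x' x y'] **[of y' x x' y] d eq by (simp add: dvd_antisym)
    with \<open>x = x'\<close> show "x = x' \<and> y = y'"
      by simp
  qed
  have img: "(\<lambda>(x, y). x * y) ` ({x. x dvd a} \<times> {y. y dvd b}) = {d. d dvd a * b}"
  proof (intro equalityI subsetI)
    fix d assume "d \<in> {d. d dvd a * b}"
    then obtain x y where "d = x * y" "x dvd a" "y dvd b"
      using division_decomp[of d a b] by auto
    then show "d \<in> (\<lambda>(x, y). x * y) ` ({x. x dvd a} \<times> {y. y dvd b})"
      by (intro image_eqI[of _ _ "(x, y)"]) auto
  qed (auto intro: mult_dvd_mono)
  have "(\<Sum>d | d dvd a * b. f d) = (\<Sum>(x, y)\<in>{x. x dvd a} \<times> {y. y dvd b}. f (x * y))"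
    unfolding img[symmetric] by (subst sum.reindex[OF inj]) (simp add: case_prod_unfold)
  then show ?thesis
    by (simp add: sum.cartesian_product)
qed

text \<open>
  Splitting off a full prime power \<open>p^k\<close> from \<open>n\<close> contributes the alternating sum
  \<open>1 - 1 + 1 - \<dots>\<close> of \<open>k + 1\<close> terms, which is \<open>1\<close> or \<open>0\<close> according to the parity of \<open>k\<close>. A number is a square if
  and only if all its exponents are even.
\<close>

lemma sum_liouville_divisors:
  assumes "n > 0"
  shows "(\<Sum>d | d dvd n. liouville d) = (if is_square n then 1 else 0)"
  using assms
proof (induction n rule: less_induct)
  case (less n)
  show ?case
  proof (cases "n = 1")
    case True
    then show ?thesis
      by (simp add: liouville_def)
  next
    case False
    then obtain p where p: "prime p" "p dvd n"
      using prime_factor_nat by blast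
    define k where "k = multiplicity p n"
    obtain m where m: "n = p ^ k * m" "\<not> p dvd m"
      using multiplicity_decompose'[of n p] less.prems p unfolding k_def by (metis not_prime_unit not_gr_zero)
    have "k > 0"
      using m p by (cases "k = 0") auto
    have "1 < p ^ k"
      by (rule one_less_power[OF prime_gt_1_nat[OF p(1)] \<open>k > 0\<close>])
    then have m0: "m > 0" "m < n"
      using m(1) less.prems by auto
    have cop: "coprime (p ^ k) m"
      using m p(1) by (simp add: prime_imp_coprime)
    have pw: "{d. d dvd p ^ k} = (\<lambda>j. p ^ j) ` {..k}"
      using divides_primepow_nat[OF p(1)] by auto
    have inj: "inj_on (\<lambda>j. p ^ j) {..k}"
      using prime_gt_1_nat[OF p(1)] by (auto intro!: inj_onI)
    have lp: "liouville (p ^ j) = (- 1) ^ j" for j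
      using p(1) by (induction j) (auto simp: liouville_mult liouville_prime prime_gt_0_nat liouville_1[simplified])
    have "(\<Sum>d | d dvd n. liouville d) = (\<Sum>x | x dvd p ^ k. \<Sum>y | y dvd m. liouville (x * y))"
      unfolding m(1) by (rule sum_divisors_coprime_mult[OF cop])
    also have "\<dots> = (\<Sum>x | x dvd p ^ k. \<Sum>y | y dvd m. liouville x * liouville y)"
      using p(1) m0 prime_gt_0_nat by (intro sum.cong refl liouville_mult) (auto intro!: Nat.gr0I)
    also have "\<dots> = (\<Sum>x | x dvd p ^ k. liouville x) * (\<Sum>y | y dvd m. liouville y)"
      by (simp add: sum_product)
    also have "(\<Sum>x | x dvd p ^ k. liouville x) = (\<Sum>j\<le>k. (- 1) ^ j)"
      unfolding pw by (subst sum.reindex[OF inj]) (simp add: lp)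
    also have "\<dots> = (if even k then 1 else 0)"
      by (induction k) auto
    also have "(\<Sum>y | y dvd m. liouville y) = (if is_square m then 1 else 0)"
      using m0 by (intro less.IH)
    also have "(if even k then 1 else 0) * (if is_square m then 1 else 0) = (if is_square n then 1 else 0 :: int)"
      unfolding m(1) is_nth_power_mult_coprime_nat_iff[OF cop] is_nth_power_prime_power_nat_iff[OF p(1)] by auto
    finally show ?thesis .
  qed
qed

definition liouville_dirichlet :: "complex \<Rightarrow> complex" where
  "liouville_dirichlet s = (\<Sum>k. of_int (liouville (Suc k)) / of_nat (Suc k) powr s)"

lemma abs_liouville: "\<bar>liouville n\<bar> = 1"
  by (simp add: liouville_def power_abs)

lemma powr_mult_of_nat:
  fixes s :: complex
  shows "of_nat (m * n) powr s = of_nat m powr s * of_nat n powr s"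
  by (simp add: powr_times_real)

lemma has_sum_pos_nat:
  fixes f :: "nat \<Rightarrow> 'a :: banach"
  assumes "summable (\<lambda>k. norm (f (Suc k)))"
  shows "(f has_sum (\<Sum>k. f (Suc k))) {0<..}"
proof -
  have "((\<lambda>k. f (Suc k)) has_sum (\<Sum>k. f (Suc k))) UNIV"
    using assms by (intro norm_summable_imp_has_sum summable_sums summable_norm_cancel[OF assms])
  then have "(f has_sum (\<Sum>k. f (Suc k))) (range Suc)"
    by (subst has_sum_reindex) (auto simp: o_def)
  also have "range Suc = {0<..}"
    by (auto simp: image_iff gr0_conv_Suc)
  finally show ?thesis .
qed

text \<open>
  The double series over pairs \<open>(d, e)\<close> is absolutely convergent and may be grouped by \<open>n = d e\<close>. By
  \<open>sum_liouville_divisors\<close> only the squares survive.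
\<close>

lemma liouville_dirichlet_times_zeta:
  assumes s: "Re s > 1"
  shows "liouville_dirichlet s * dirichlet_zeta s = dirichlet_zeta (2 * s)"
proof -
  define w where "w n = 1 / of_nat n powr s" for n :: nat
  define l where "l n = (of_int (liouville n) :: complex)" for n
  have w_mult: "w (m * n) = w m * w n" for m n
    unfolding w_def powr_mult_of_nat by simp
  have nl: "norm (l n * w n) = norm (w n)" for n
    by (simp add: l_def norm_mult abs_liouville flip: of_int_abs)
  have sw: "summable (\<lambda>k. norm (w (Suc k)))"
    unfolding w_def by (rule summable_norm_dirichlet_zeta[OF s])
  have w_sum: "(w has_sum dirichlet_zeta s) {0<..}"
    using has_sum_pos_nat[of w, OF sw] by (simp add: w_def dirichlet_zeta_def)
  have l_sum: "((\<lambda>n. l n * w n) has_sum liouville_dirichlet s) {0<..}"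
    using has_sum_pos_nat[of "\<lambda>n. l n * w n"] sw unfolding nl by (simp add: w_def l_def liouville_dirichlet_def)
  have abs_w: "(\<lambda>n. norm (w n)) summable_on {0<..}"
    using has_sum_pos_nat[of "\<lambda>n. norm (w n)"] sw by (auto simp: summable_on_def)
  define W where "W = infsum (\<lambda>n. norm (w n)) {0<..}"
  have W: "((\<lambda>n. norm (w n)) has_sum W) {0<..}"
    unfolding W_def by (rule has_sum_infsum[OF abs_w])
  define P where "P = (\<lambda>(d, e). l d * w d * w e)"
  have "(\<lambda>x. norm (P x)) summable_on ({0<..} \<times> {0<..})"
  proof (rule summable_on_SigmaI)
    show "((\<lambda>e. norm (P (d, e))) has_sum (norm (w d) * W)) {0<..}" for d
      using has_sum_cmult_right[OF W, of "norm (w d)"] by (simp add: P_def norm_mult nl[unfolded norm_mult])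
    show "(\<lambda>d. norm (w d) * W) summable_on {0<..}"
      using summable_on_cmult_left[OF abs_w, of W] by simp
  qed simp
  then have P: "P summable_on ({0<..} \<times> {0<..})"
    by (rule abs_summable_summable)
  have "(P has_sum (liouville_dirichlet s * dirichlet_zeta s)) ({0<..} \<times> {0<..})"
  proof (rule has_sum_SigmaI[OF _ _ P])
    show "((\<lambda>e. P (d, e)) has_sum (l d * w d * dirichlet_zeta s)) {0<..}" for d
      using has_sum_cmult_right[OF w_sum, of "l d * w d"] by (simp add: P_def)
    show "((\<lambda>d. l d * w d * dirichlet_zeta s) has_sum (liouville_dirichlet s * dirichlet_zeta s)) {0<..}"
      by (rule has_sum_cmult_left[OF l_sum])
  qed
  also have "?this \<longleftrightarrow> ((\<lambda>(n, d). l d * w n) has_sum (liouville_dirichlet s * dirichlet_zeta s))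
      (Sigma {0<..} (\<lambda>n. {d. d dvd n}))"
    by (rule has_sum_reindex_bij_witness[where i = "\<lambda>(n, d). (d, n div d)" and j = "\<lambda>(d, e). (d * e, d)"])
       (auto simp: P_def w_mult mult.assoc intro: Nat.gr0I)
  finally have "((\<lambda>n. (if is_square n then 1 else 0) * w n) has_sum (liouville_dirichlet s * dirichlet_zeta s)) {0<..}"
  proof (rule has_sum_SigmaD)
    fix n :: nat assume n: "n \<in> {0<..}"
    have "(\<Sum>d | d dvd n. l d * w n) = of_int (\<Sum>d | d dvd n. liouville d) * w n"
      by (simp add: l_def sum_distrib_right)
    also have "\<dots> = (if is_square n then 1 else 0) * w n"
      using n by (simp add: sum_liouville_divisors)
    finally show "((\<lambda>d. case (n, d) of (n, d) \<Rightarrow> l d * w n) has_sum ((if is_square n then 1 else 0) * w n)) {d. d dvd n}"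
      using n has_sum_finite[of "{d. d dvd n}" "\<lambda>d. l d * w n"] by simp
  qed
  also have "?this \<longleftrightarrow> (w has_sum (liouville_dirichlet s * dirichlet_zeta s)) ((\<lambda>n. n ^ 2) ` {0<..})"
    by (rule has_sum_cong_neutral) (auto simp: is_nth_power_def)
  also have "\<dots> \<longleftrightarrow> ((w \<circ> (\<lambda>n. n ^ 2)) has_sum (liouville_dirichlet s * dirichlet_zeta s)) {0<..}"
    by (rule has_sum_reindex) (auto intro!: inj_onI)
  finally have A: "((\<lambda>n. w (n ^ 2)) has_sum (liouville_dirichlet s * dirichlet_zeta s)) {0<..}"
    by (simp add: o_def)
  have w2: "w (n ^ 2) = 1 / of_nat n powr (2 * s)" for n
  proof -
    have "of_nat n powr (2 * s) = of_nat n powr s * of_nat n powr s"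
      unfolding mult_2 by (rule powr_add)
    then show ?thesis
      unfolding power2_eq_square w_mult unfolding w_def by simp
  qed
  have "((\<lambda>n. w (n ^ 2)) has_sum dirichlet_zeta (2 * s)) {0<..}"
    unfolding w2 dirichlet_zeta_def
    by (rule has_sum_pos_nat[OF summable_norm_dirichlet_zeta]) (use s in simp)
  with A show ?thesis
    by (rule has_sum_unique)
qed

text \<open>
  By the previous identity a zero \<open>s\<close> would produce the zero \<open>2 s\<close>. But for \<open>Re s > 1\<close> the value of the series at \<open>2 s\<close> differs from \<open>1\<close>
  by at most \<open>\<pi>\<^sup>2 / 6 - 1 < 1\<close>.
\<close>

lemma dirichlet_zeta_nonzero:
  assumes s: "Re s > 1"
  shows "dirichlet_zeta s \<noteq> 0"
proof
  assume "dirichlet_zeta s = 0"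
  then have z: "dirichlet_zeta (2 * s) = 0"
    using liouville_dirichlet_times_zeta[OF s] by simp
  let ?f = "\<lambda>k. 1 / of_nat (Suc k) powr (2 * s)"
  have s2: "Re (2 * s) > 1"
    using s by simp
  have "?f sums 0"
    using dirichlet_zeta_sums[OF s2] z by simp
  then have "(\<lambda>k. ?f (Suc k)) sums (0 - ?f 0)"
    by (subst sums_Suc_iff) simp
  then have m1: "(\<lambda>k. ?f (Suc k)) sums (- 1)"
    by simp
  have sq: "(\<lambda>k. 1 / real (Suc (Suc k)) ^ 2) sums (pi ^ 2 / 6 - 1)"
  proof -
    have "(\<lambda>k. 1 / real (Suc k) ^ 2) sums (pi ^ 2 / 6)"
      using inverse_squares_sums by simp
    then show ?thesis
      by (subst sums_Suc_iff[where f = "\<lambda>k. 1 / real (Suc k) ^ 2"]) simp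
  qed
  have le: "norm (?f (Suc k)) \<le> 1 / real (Suc (Suc k)) ^ 2" for k
  proof -
    have "norm (?f (Suc k)) = real (Suc (Suc k)) powr - Re (2 * s)"
      by (rule norm_powr_neg_nat)
    also have "\<dots> \<le> real (Suc (Suc k)) powr - 2"
      using s by (intro powr_mono) auto
    also have "\<dots> = 1 / real (Suc (Suc k)) ^ 2"
      by (simp add: powr_minus_divide del: of_nat_Suc)
    finally show ?thesis .
  qed
  have "norm (\<Sum>k. ?f (Suc k)) \<le> (\<Sum>k. 1 / real (Suc (Suc k)) ^ 2)"
    by (rule norm_suminf_le[OF le sums_summable[OF sq]])
  then have "norm (- 1 :: complex) \<le> pi ^ 2 / 6 - 1"
    unfolding sums_unique[OF m1, symmetric] sums_unique[OF sq, symmetric] .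
  then have "1 \<le> pi ^ 2 / 6 - 1"
    by simp
  moreover have "pi ^ 2 < (3.2 :: real) ^ 2"
    using pi_approx by (intro power_strict_mono) auto
  ultimately show False
    by (simp add: power2_eq_square)
qed

section \<open>Landau's theorem applied to the Liouville sine series\<close>

definition liouville_real_series :: "real \<Rightarrow> real" where
  "liouville_real_series \<sigma> = (\<Sum>k. of_int (liouville (Suc k)) * real (Suc k) powr - \<sigma>)"

lemma summable_liouville_real_series:
  assumes "\<sigma> > 1"
  shows "summable (\<lambda>k. of_int (liouville (Suc k)) * real (Suc k) powr - \<sigma>)"
  by (rule summable_rabs_cancel)
     (use summable_zeta_series[OF assms] in \<open>simp add: abs_mult abs_liouville flip: of_int_abs\<close>)

lemma liouville_real_series_times_zeta:
  assumes \<sigma>: "\<sigma> > 1"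
  shows "liouville_real_series \<sigma> * zeta_series \<sigma> = zeta_series (2 * \<sigma>)"
proof -
  have "of_int (liouville (Suc k)) / of_nat (Suc k) powr of_real \<sigma> =
      complex_of_real (of_int (liouville (Suc k)) * real (Suc k) powr - \<sigma>)" for k
    using powr_neg_nat_of_real[of k \<sigma>]
    by (metis (no_types, lifting) mult.right_neutral of_real_mult of_real_of_int_eq times_divide_eq_right)
  then have "liouville_dirichlet (of_real \<sigma>) = of_real (liouville_real_series \<sigma>)"
    unfolding liouville_dirichlet_def liouville_real_series_def
    by (simp only: suminf_of_real[OF summable_liouville_real_series[OF \<sigma>]])
  moreover have "dirichlet_zeta (2 * of_real \<sigma>) = of_real (zeta_series (2 * \<sigma>))"
    using dirichlet_zeta_of_real[of "2 * \<sigma>"] \<sigma> by simp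
  ultimately have "complex_of_real (liouville_real_series \<sigma> * zeta_series \<sigma>) = of_real (zeta_series (2 * \<sigma>))"
    using liouville_dirichlet_times_zeta[of "of_real \<sigma>"] \<sigma> by (simp add: dirichlet_zeta_of_real)
  then show ?thesis
    by (simp only: of_real_eq_iff)
qed

text \<open>
  Rescaling moves the right end of the interval where \<open>f\<close> is nonnegative to \<open>1\<close>, the point at which the
  Mellin integrals are split.
\<close>

definition quarter_liouville_sine :: "real \<Rightarrow> real" where
  "quarter_liouville_sine x = liouville_sine (x / 4)"

lemma borel_measurable_quarter_liouville_sine [measurable]:
  "quarter_liouville_sine \<in> borel_measurable borel"
  unfolding quarter_liouville_sine_def[abs_def] liouville_sine_def by measurable

lemma has_mellin_quarter_liouville_sine:
  assumes w: "-1 < w" "w < 0"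
  shows "has_mellin quarter_liouville_sine w
    (Gamma w * sin (pi * w / 2) * ((pi / 2) powr - w * liouville_real_series (2 + w)))"
proof -
  define c where "c k = of_int (liouville (Suc k)) / real (Suc k) ^ 2" for k
  define a where "a k = pi / 2 * real (Suc k)" for k
  have eq: "c k * a k powr - w = (pi / 2) powr - w * (of_int (liouville (Suc k)) * real (Suc k) powr - (2 + w))" for k
  proof -
    have "real (Suc k) powr - (2 + w) = real (Suc k) powr - 2 * real (Suc k) powr - w"
      by (simp flip: powr_add)
    also have "real (Suc k) powr - 2 = 1 / real (Suc k) ^ 2"
      by (simp add: powr_minus_divide del: of_nat_Suc)
    finally show ?thesis
      unfolding a_def c_def powr_mult by (simp del: of_nat_Suc)
  qed
  have abs_c: "\<bar>c k\<bar> = 1 / real (Suc k) ^ 2" for k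
    unfolding c_def by (simp add: abs_liouville flip: of_int_abs del: of_nat_Suc)
  have "has_mellin quarter_liouville_sine w (Gamma w * sin (pi * w / 2) * (\<Sum>k. c k * a k powr - w))"
  proof (rule has_mellin_series[OF has_mellin_sin[OF w]])
    show "a k > 0" for k
      by (simp add: a_def)
    have "\<bar>c k\<bar> * a k powr - w = (pi / 2) powr - w * real (Suc k) powr - (2 + w)" for k
    proof -
      have "\<bar>c k\<bar> * a k powr - w = \<bar>c k * a k powr - w\<bar>"
        by (simp add: abs_mult)
      also have "\<dots> = (pi / 2) powr - w * real (Suc k) powr - (2 + w)"
        unfolding eq by (simp add: abs_mult abs_liouville flip: of_int_abs)
      finally show ?thesis .
    qed
    then show "summable (\<lambda>k. \<bar>c k\<bar> * a k powr - w)"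
      using summable_mult[OF summable_zeta_series[of "2 + w"], of "(pi / 2) powr - w"] w by simp
    fix x :: real
    show "summable (\<lambda>k. \<bar>c k * sin (a k * x)\<bar>)"
    proof (rule summable_comparison_test')
      show "summable (\<lambda>k. 1 / real (Suc k) ^ 2)"
        using sums_summable[OF inverse_squares_sums] by simp
      show "norm \<bar>c k * sin (a k * x)\<bar> \<le> 1 / real (Suc k) ^ 2" for k
        unfolding abs_c[symmetric] by (simp add: abs_mult mult_left_le)
    qed
    show "quarter_liouville_sine x = (\<Sum>k. c k * sin (a k * x))"
    proof -
      have "2 * pi * real (Suc k) * (x / 4) = a k * x" for k
        by (simp add: a_def del: of_nat_Suc)
      then show ?thesis
        unfolding quarter_liouville_sine_def liouville_sine_def c_def
        by (simp only: times_divide_eq_left)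
    qed
  qed
  also have "(\<Sum>k. c k * a k powr - w) = (pi / 2) powr - w * liouville_real_series (2 + w)"
    unfolding eq liouville_real_series_def using w by (intro suminf_mult summable_liouville_real_series) simp
  finally show ?thesis .
qed

text \<open>
  The function \<open>(s - 1) \<zeta>(s)\<close> with the value \<open>1\<close> at the removable singularity \<open>1\<close>. It replaces \<open>\<zeta>\<close> in the
  denominator, so that the exponent corresponding to the pole of \<open>\<zeta>\<close> needs no exception in Landau's theorem.
\<close>

definition zeta_pole_free :: "complex \<Rightarrow> complex" where
  "zeta_pole_free s = rGamma s * ((s - 1) * mellin bose_kernel s + 1) - (s - 1) * rGamma (s + 1) / 2"

lemma zeta_pole_free_eq: "s \<noteq> 1 \<Longrightarrow> zeta_pole_free s = (s - 1) * zeta_right s"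
  by (simp add: zeta_pole_free_def zeta_right_def field_simps)

lemma zeta_pole_free_1: "zeta_pole_free 1 = 1"
  by (simp add: zeta_pole_free_def)

lemma zeta_pole_free_holomorphic: "zeta_pole_free holomorphic_on {s. -1 < Re s}"
  unfolding zeta_pole_free_def[abs_def]
  by (intro holomorphic_intros mellin_holomorphic_right) (auto intro: mellin_integrable_bose_kernel)

lemma zeta_pole_free_of_real_nonzero:
  assumes s: "s > 0"
  shows "zeta_pole_free (of_real s) \<noteq> 0"
proof -
  consider "s < 1" | "s = 1" | "s > 1"
    by linarith
  then show ?thesis
  proof cases
    case 1
    then show ?thesis
      using zeta_right_of_real_nonzero[OF s] by (simp add: zeta_pole_free_eq)
  next
    case 2
    then show ?thesis
      by (simp add: zeta_pole_free_1)
  next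
    case 3
    then show ?thesis
      using dirichlet_zeta_nonzero[of "of_real s"] by (simp add: zeta_pole_free_eq zeta_right_eq_dirichlet_zeta)
  qed
qed

text \<open>
  From here on \<open>t = -w\<close>, so that Landau's theorem extends the range of convergence to the right. The
  factor \<open>1 - t\<close> in \<open>zeta_pole_free (2 - t)\<close> cancels the pole of \<open>\<Gamma>(-t)\<close> at \<open>1\<close> by
  \<open>(1 - t) \<Gamma>(-t) = -\<Gamma>(2 - t) / t\<close>. The resulting numerator is holomorphic and zero-free in the whole
  strip \<open>0 < Re t < 3/2\<close>, that is, for \<open>1/2 < Re (2 - t) < 2\<close>.
\<close>

definition mellin_factor :: "complex \<Rightarrow> complex" where
  "mellin_factor t = of_real (pi / 2) powr t * Gamma (2 - t) * (sin (of_real pi * t / 2) / t) * dirichlet_zeta (4 - 2 * t)"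

lemma mellin_factor_holomorphic: "mellin_factor holomorphic_on {t. 0 < Re t \<and> Re t < 3 / 2}"
proof -
  have "(\<lambda>t. dirichlet_zeta (4 - 2 * t)) holomorphic_on {t. 0 < Re t \<and> Re t < 3 / 2}"
    by (rule holomorphic_on_compose_gen[OF _ dirichlet_zeta_holomorphic, unfolded comp_def])
       (auto intro!: holomorphic_intros)
  then show ?thesis
    unfolding mellin_factor_def[abs_def]
    by (intro holomorphic_intros) (auto simp: Re_pos_not_nonpos_Int)
qed

lemma sin_half_pi_nonzero:
  fixes t :: complex
  assumes "\<And>n::int. t \<noteq> 2 * of_int n"
  shows "sin (of_real pi * t / 2) \<noteq> 0"
proof
  assume "sin (of_real pi * t / 2) = 0"
  then obtain n :: int where "of_real pi * t / 2 = of_real (real_of_int n * pi)"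
    by (auto simp: sin_eq_0)
  then have "t = 2 * of_int n"
    by (simp add: field_simps)
  then show False
    using assms by blast
qed

lemma mellin_factor_nonzero:
  assumes t: "0 < Re t" "Re t < 3 / 2"
  shows "mellin_factor t \<noteq> 0"
proof -
  have "t \<noteq> 2 * of_int n" for n :: int
  proof
    assume "t = 2 * of_int n"
    then have "0 < n" "n < 1"
      using t by auto
    then show False
      by linarith
  qed
  then have "sin (of_real pi * t / 2) \<noteq> 0"
    by (rule sin_half_pi_nonzero)
  moreover have "t \<noteq> 0"
    using t by auto
  moreover have "Gamma (2 - t) \<noteq> 0"
    using t by (simp add: Gamma_eq_zero_iff Re_pos_not_nonpos_Int)
  moreover have "dirichlet_zeta (4 - 2 * t) \<noteq> 0"
    using t by (intro dirichlet_zeta_nonzero) simp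
  ultimately show ?thesis
    by (simp add: mellin_factor_def)
qed

lemma mellin_quarter_liouville_sine_identity:
  assumes t: "0 < t" "t < 1"
  shows "zeta_pole_free (2 - of_real t) * mellin quarter_liouville_sine (- of_real t) = mellin_factor (of_real t)"
proof -
  define v where "v = Gamma (- t) * sin (pi * (- t) / 2) * ((pi / 2) powr t * liouville_real_series (2 - t))"
  have "mellin quarter_liouville_sine (of_real (- t)) = of_real v"
    using has_mellin_quarter_liouville_sine[of "- t"] t by (intro mellin_of_real) (simp add: v_def)
  moreover have "zeta_pole_free (2 - of_real t) = of_real ((1 - t) * zeta_series (2 - t))"
  proof -
    have "complex_of_real (2 - t) \<noteq> 1"
      unfolding of_real_eq_1_iff using t by simp
    then have "zeta_pole_free (of_real (2 - t)) = (of_real (2 - t) - 1) * zeta_right (of_real (2 - t))"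
      by (rule zeta_pole_free_eq)
    also have "zeta_right (of_real (2 - t)) = of_real (zeta_series (2 - t))"
      using t by (intro zeta_right_of_real_gt_1) simp
    finally show ?thesis
      by simp
  qed
  ultimately have "zeta_pole_free (2 - of_real t) * mellin quarter_liouville_sine (- of_real t) =
      of_real ((1 - t) * zeta_series (2 - t) * v)"
    by simp
  also have "(1 - t) * zeta_series (2 - t) * v =
     (1 - t) * Gamma (- t) * sin (pi * (- t) / 2) * (pi / 2) powr t * (liouville_real_series (2 - t) * zeta_series (2 - t))"
    by (simp add: v_def)
  also have "liouville_real_series (2 - t) * zeta_series (2 - t) = zeta_series (4 - 2 * t)"
    using liouville_real_series_times_zeta[of "2 - t"] t by (simp add: algebra_simps)
  also have "(1 - t) * Gamma (- t) = - (Gamma (2 - t) / t)"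
  proof -
    have "- t \<notin> \<int>\<^sub>\<le>\<^sub>0"
    proof
      assume "- t \<in> \<int>\<^sub>\<le>\<^sub>0"
      then obtain n where "- t = of_int n"
        by (elim nonpos_Ints_cases)
      then have "real_of_int (- 1) < of_int n" "real_of_int n < of_int 0"
        using t by (simp_all flip: \<open>- t = of_int n\<close>)
      then show False
        unfolding of_int_less_iff by simp
    qed
    moreover have "1 - t \<notin> \<int>\<^sub>\<le>\<^sub>0"
      using t by (auto elim!: nonpos_Ints_cases)
    ultimately have "Gamma (- t + 1) = - t * Gamma (- t)" "Gamma ((1 - t) + 1) = (1 - t) * Gamma (1 - t)"
      by (intro Gamma_plus1; simp)+
    then show ?thesis
      using t by (simp add: field_simps)
  qed
  also have "- (Gamma (2 - t) / t) * sin (pi * (- t) / 2) * (pi / 2) powr t * zeta_series (4 - 2 * t) =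
      (pi / 2) powr t * Gamma (2 - t) * (sin (pi * t / 2) / t) * zeta_series (4 - 2 * t)"
    by simp
  also have "of_real \<dots> = mellin_factor (of_real t)"
  proof -
    have "of_real (pi / 2) powr of_real t = complex_of_real ((pi / 2) powr t)"
      by (rule powr_of_real) simp
    moreover have "Gamma (2 - of_real t) = complex_of_real (Gamma (2 - t))"
      by (metis Gamma_complex_of_real of_real_diff of_real_numeral)
    moreover have "sin (of_real pi * of_real t / 2) = complex_of_real (sin (pi * t / 2))"
      using sin_of_real[of "pi * t / 2", where 'a = complex] by simp
    moreover have "dirichlet_zeta (4 - 2 * of_real t) = of_real (zeta_series (4 - 2 * t))"
      using dirichlet_zeta_of_real[of "4 - 2 * t"] t by simp
    ultimately show ?thesis
      by (simp only: mellin_factor_def of_real_mult of_real_divide)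
  qed
  finally show ?thesis .
qed

text \<open>
  The part of the transform over \<open>(0, 1]\<close> is the integral of the nonnegative function \<open>f(x/4) / x\<close> against \<open>exp (t L)\<close>
  with \<open>L = -ln x \<ge> 0\<close>, and Landau's theorem shows that it converges for \<open>t < 3/2\<close>. The identity then
  holds in the whole strip, and a zero of \<open>\<zeta>(2 - t)\<close> would force the zero-free numerator to vanish.
\<close>

lemma zeta_pole_free_nonzero_if_liouville_sine_nonneg:
  assumes nonneg: "\<And>x::real. 0 \<le> x \<Longrightarrow> x \<le> 1 / 4 \<Longrightarrow> liouville_sine x \<ge> 0"
    and s: "1 / 2 < Re s" "Re s < 2"
  shows "zeta_pole_free s \<noteq> 0"
proof -
  define h where "h = quarter_liouville_sine"
  define h1 where "h1 x = (if x \<le> 1 then h x else 0)" for x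
  define h2 where "h2 x = (if x \<le> 1 then 0 else h x)" for x
  have [measurable]: "h \<in> borel_measurable borel"
    unfolding h_def by measurable
  have [measurable]: "h1 \<in> borel_measurable borel" "h2 \<in> borel_measurable borel"
    unfolding h1_def[abs_def] h2_def[abs_def] by measurable
  have h_int: "mellin_integrable h \<sigma>" if "-1 < \<sigma>" "\<sigma> < 0" for \<sigma>
    unfolding h_def by (rule has_mellin_integrable[OF has_mellin_quarter_liouville_sine[OF that]])
  have h1_int: "mellin_integrable h1 \<sigma>" if "-1 < \<sigma>" "\<sigma> < 0" for \<sigma>
    unfolding h1_def using h_int[OF that] by (rule mellin_integrable_near_0[rotated]) auto
  have h2_int: "mellin_integrable h2 \<sigma>" if "\<sigma> < 0" for \<sigma>
    unfolding h2_def
  proof (rule mellin_integrable_near_infinity)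
    show "mellin_integrable h (max \<sigma> (- 1 / 2))"
      using that by (intro h_int) auto
  qed auto
  define F where "F x = indicat_real {0<..} x * h1 x / x" for x
  define L where "L x = - ln x" for x :: real
  have mellin_h1: "(LINT x|lborel. of_real (F x) * exp (t * of_real (L x))) = mellin h1 (- t)" for t
    by (simp add: mellin_def F_def L_def)
  define Z where "Z t = zeta_pole_free (2 - t)" for t
  define K where "K t = mellin_factor t - Z t * mellin h2 (- t)" for t
  let ?S = "{t. 0 < Re t \<and> Re t < 3 / 2}"
  have Z_hol: "Z holomorphic_on ?S"
    unfolding Z_def[abs_def]
    by (rule holomorphic_on_compose_gen[OF _ zeta_pole_free_holomorphic, unfolded comp_def])
       (auto intro!: holomorphic_intros)
  \<comment> \<open>Any lower bound up to \<open>-3/2\<close> would do in place of the \<open>-2\<close> below.\<close>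
  have h2_hol: "(\<lambda>t. mellin h2 (- t)) holomorphic_on ?S"
  proof (rule holomorphic_on_compose_gen[OF _ mellin_holomorphic, unfolded comp_def])
    show "uminus holomorphic_on ?S"
      by (intro holomorphic_intros)
    show "uminus ` ?S \<subseteq> {s. - 2 < Re s \<and> Re s < 0}"
      by auto
  qed (auto intro: h2_int)
  have split: "mellin h (- of_real t) = mellin h1 (- of_real t) + mellin h2 (- of_real t)" if t: "0 < t" "t < 1" for t
  proof -
    obtain u v where u: "has_mellin h1 (- t) u" and v: "has_mellin h2 (- t) v"
      using h1_int[of "- t"] h2_int[of "- t"] t mellin_integrableD by fastforce
    have "has_mellin (\<lambda>x. h1 x + h2 x) (- t) (u + v)"
      using u v by (rule has_mellin_add)
    also have "(\<lambda>x. h1 x + h2 x) = h"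
      by (auto simp: h1_def h2_def)
    finally have "mellin h (of_real (- t)) = of_real (u + v)"
      by (rule mellin_of_real)
    then show ?thesis
      using mellin_of_real[OF u] mellin_of_real[OF v] by simp
  qed
  \<comment> \<open>The starting exponent \<open>1/2\<close> may be any number in \<open>(0, 1)\<close>, where the transforms are known to exist.\<close>
  have key: "Z t * mellin h1 (- t) = K t" if t: "0 < Re t" "Re t < 3 / 2" for t
    unfolding mellin_h1[symmetric]
  proof (rule landau_exp_integral[where A = 0 and B = "3 / 2" and ?t1.0 = "1 / 2"])
    show "F \<in> borel_measurable lborel" "L \<in> borel_measurable lborel"
      unfolding F_def[abs_def] L_def[abs_def] by measurable
    show "F x \<ge> 0" for x
      using nonneg[of "x / 4"] by (auto simp: F_def h1_def h_def quarter_liouville_sine_def indicator_def)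
    show "L x \<ge> 0" if "F x > 0" for x
    proof -
      have "0 < x" "x \<le> 1"
        using that by (cases "0 < x"; cases "x \<le> 1"; simp add: F_def h1_def)+
      then show ?thesis
        by (simp add: L_def)
    qed
    have "integrable lborel (\<lambda>x. norm (complex_of_real (F x)) * exp (- (1 / 2) * ln x))"
      unfolding F_def by (intro mellin_integrable_exp h1_int) auto
    moreover have "norm (complex_of_real (F x)) = F x" for x
      using \<open>\<And>x. F x \<ge> 0\<close> by simp
    ultimately show "integrable lborel (\<lambda>x. F x * exp (1 / 2 * L x))"
      by (simp add: L_def)
    show "K holomorphic_on ?S"
      unfolding K_def[abs_def] by (intro holomorphic_intros mellin_factor_holomorphic Z_hol h2_hol)
    show "Z (of_real t) \<noteq> 0" if "1 / 2 \<le> t" "t < 3 / 2" for t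
      using zeta_pole_free_of_real_nonzero[of "2 - t"] that by (simp add: Z_def)
    show "Z (of_real t) * (LINT x|lborel. of_real (F x) * exp (of_real t * of_real (L x))) = K (of_real t)"
      if "0 < t" "t < 1 / 2" for t
      using mellin_quarter_liouville_sine_identity[of t] split[of t] that
      unfolding mellin_h1 K_def Z_def h_def by (simp add: algebra_simps)
  qed (use t Z_hol in auto)
  show ?thesis
  proof
    assume "zeta_pole_free s = 0"
    then have "Z (2 - s) = 0"
      by (simp add: Z_def)
    then have "mellin_factor (2 - s) = 0"
      using key[of "2 - s"] s by (simp add: K_def)
    then show False
      using mellin_factor_nonzero[of "2 - s"] s by simp
  qed
qed

lemma zeta_reflected_nonzero:
  assumes "Re s < 1" "s \<noteq> 0" "\<And>n::nat. n \<ge> 1 \<Longrightarrow> s \<noteq> - 2 * of_nat n"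
  shows "zeta_reflected s \<noteq> 0"
proof -
  have "s \<noteq> 2 * of_int n" for n :: int
  proof
    assume n: "s = 2 * of_int n"
    then have "n \<le> 0" "n \<noteq> 0"
      using assms(1,2) by auto
    then have "nat (- n) \<ge> 1" "s = - 2 * of_nat (nat (- n))"
      using n by auto
    then show False
      using assms(3) by blast
  qed
  then have "sin (of_real pi * s / 2) \<noteq> 0"
    by (rule sin_half_pi_nonzero)
  moreover have "Gamma (1 - s) \<noteq> 0"
    using assms(1) by (simp add: Gamma_eq_zero_iff Re_pos_not_nonpos_Int)
  ultimately show ?thesis
    by (simp add: zeta_reflected_def)
qed

theorem theorem1:
  assumes "\<And>x::real. 0 \<le> x \<Longrightarrow> x \<le> 1 / 4 \<Longrightarrow> liouville_sine x \<ge> 0"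
  shows "Riemann_Hypothesis"
proof -
  have right: "riemann_zeta s \<noteq> 0" if "Re s > 1 / 2" "s \<noteq> 1" for s
  proof (cases "Re s > 1")
    case True
    then show ?thesis
      by (simp add: riemann_zeta_eq_dirichlet_zeta dirichlet_zeta_nonzero)
  next
    case False
    then have "zeta_pole_free s \<noteq> 0"
      using that by (intro zeta_pole_free_nonzero_if_liouville_sine_nonneg assms) auto
    then show ?thesis
      using that by (simp add: riemann_zeta_eq_right zeta_pole_free_eq)
  qed
  show ?thesis
    unfolding Riemann_Hypothesis_def
  proof (intro allI impI)
    fix s assume s: "s \<noteq> 1" "riemann_zeta s = 0" "\<nexists>n::nat. n \<ge> 1 \<and> s = - 2 * of_nat n"
    have "s \<noteq> 0"
      using s(2) by (auto simp: riemann_zeta_eq_right zeta_right_0)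
    have "\<not> Re s < 1 / 2"
    proof
      assume lt: "Re s < 1 / 2"
      then have "riemann_zeta s = zeta_reflected s * riemann_zeta (1 - s)"
        using \<open>s \<noteq> 0\<close> by (intro riemann_zeta_functional_equation) auto
      moreover have "zeta_reflected s \<noteq> 0"
        using lt s(3) \<open>s \<noteq> 0\<close> by (intro zeta_reflected_nonzero) auto
      moreover have "riemann_zeta (1 - s) \<noteq> 0"
        using lt \<open>s \<noteq> 0\<close> by (intro right) auto
      ultimately show False
        using s(2) by simp
    qed
    moreover have "\<not> Re s > 1 / 2"
      using right s(1,2) by blast
    ultimately show "Re s = 1 / 2"
      by simp
  qed
qed

end
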